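(* Let $\Gamma$ be a group of polynomial growth of degree $d \in \mathbb{Z}_{\geq 0}$ and let $(\alpha,\beta) \subset \mathbb{R}_{>0}$ be a nonempty interval. Then there are constants $c_1, c_2 \in \mathbb{R}_{>0}$ with $c_2 < 1$, which depend only on $\Gamma$, $\alpha$ and $\beta$, such that the following holds. For any probability space $\mathrm{X} = (X, \mathcal{B}, \mu)$, any measure-preserving action of $\Gamma$ on $\mathrm{X}$ and any measurable function $f \geq 0$ on $X$ we have $$\mu\left(\left\{ x \in X : \left(\mathbb{E}_{g \in \mathrm{B}(k)} f(g \cdot x)\right)_{k \geq 1} \in \mathcal{F}_{(\alpha,\beta)}^N \right\}\right) < c_1 c_2^N$$ for all integers $N \geq 1$.
   Context: Let $\Gamma$ be a finitely generated group with a fixed finite generating set $\{\gamma_1,\dots,\gamma_k\}$ (this choice is part of the data of $\Gamma$). The norm of $\gamma\in\Gamma$ is $\|\gamma\| := \inf\{\sum_{i=1}^l |p_i| : \gamma = \gamma_{i_1}^{p_1}\cdots\gamma_{i_l}^{p_l},\ p_i \in \mathbb{Z}\}$, i.e. the word length. For real $n \geq 0$, $\mathrm{B}(n) := \{\gamma \in \Gamma : \|\gamma\| \leq n\}$, and the growth function is $\gamma(n) := |\mathrm{B}(n)|$, where $|\cdot|$ denotes cardinality. $\Gamma$ is of polynomial growth if there are constants $C, d > 0$ with $\gamma(n) \leq C(n^d+1)$ for all $n \geq 1$. It is known that then there is a unique integer $d \geq 0$, called the degree of polynomial growth, for which there is a constant $C>0$ with $\frac{1}{C} n^d \leq \gamma(n)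 \leq C n^d$ for all integers $n \geq 1$. For a finite nonempty set $F$, $\mathbb{E}_{g \in F} f(g) := \frac{1}{|F|}\sum_{g \in F} f(g)$. Notation: $\mathbb{R}_{>0} = (0,\infty)$. Given $\alpha<\beta$ and an integer $n \geq 0$, a finite real sequence $(a_i)_{i=1}^k$ fluctuates at least $n$ times across $(\alpha,\beta)$ if there are indices $1 \leq i_0 < i_1 < \dots < i_n \leq k$ such that $a_{i_j} < \alpha$ if $j$ is odd and $a_{i_j} > \beta$ if $j$ is even. An infinite real sequence $(a_i)_{i \geq 1}$ fluctuates at least $n$ times across $(\alpha,\beta)$ if some initial segment $(a_i)_{i=1}^k$ does. $\mathcal{F}_{(\alpha,\beta)}^n$ denotes the set of all real sequences having at least $n$ fluctuations across $(\alpha,\beta)$. *)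

theory Defs
  imports "HOL-Probability.Probability" "HOL-Algebra.Generated_Groups" "HOL-Algebra.Group_Action"
begin

definition generating_set :: "('g, 'b) monoid_scheme \<Rightarrow> 'g set \<Rightarrow> bool" where
  "generating_set G S \<longleftrightarrow> finite S \<and> S \<subseteq> carrier G \<and> generate G S = carrier G"

text \<open>A word is a list of pairs (generator, integer exponent).\<close>

definition word_value :: "('g, 'b) monoid_scheme \<Rightarrow> ('g \<times> int) list \<Rightarrow> 'g" where
  "word_value G w = foldr (\<lambda>(s, p) y. (s [^]\<^bsub>G\<^esub> p) \<otimes>\<^bsub>G\<^esub> y) w \<one>\<^bsub>G\<^esub>"

definition word_cost :: "('g \<times> int) list \<Rightarrow> nat" where
  "word_cost w = (\<Sum>(s, p)\<leftarrow>w. nat \<bar>p\<bar>)"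

definition word_norm :: "('g, 'b) monoid_scheme \<Rightarrow> 'g set \<Rightarrow> 'g \<Rightarrow> nat" where
  "word_norm G S \<gamma> = Inf {word_cost w | w. set w \<subseteq> S \<times> UNIV \<and> \<gamma> = word_value G w}"

definition word_ball :: "('g, 'b) monoid_scheme \<Rightarrow> 'g set \<Rightarrow> real \<Rightarrow> 'g set" where
  "word_ball G S r = {\<gamma> \<in> carrier G. real (word_norm G S \<gamma>) \<le> r}"

definition growth :: "('g, 'b) monoid_scheme \<Rightarrow> 'g set \<Rightarrow> real \<Rightarrow> nat" where
  "growth G S r = card (word_ball G S r)"

definition polynomial_growth :: "('g, 'b) monoid_scheme \<Rightarrow> 'g set \<Rightarrow> bool" where
  "polynomial_growth G S \<longleftrightarrow>
     (\<exists>C d :: real. 0 < C \<and> 0 < d \<and> (\<forall>r\<ge>1. real (growth G S r) \<le> C * (r powr d + 1)))"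

definition growth_degree :: "('g, 'b) monoid_scheme \<Rightarrow> 'g set \<Rightarrow> nat \<Rightarrow> bool" where
  "growth_degree G S d \<longleftrightarrow>
     (\<exists>C::real. 0 < C \<and> (\<forall>n::nat. 1 \<le> n \<longrightarrow>
        1 / C * real n ^ d \<le> real (growth G S (real n)) \<and>
        real (growth G S (real n)) \<le> C * real n ^ d))"

definition avg :: "'g set \<Rightarrow> ('g \<Rightarrow> real) \<Rightarrow> real" where
  "avg F f = (\<Sum>g\<in>F. f g) / real (card F)"

text \<open>Sequences are indexed from 1: the value of \<^term>\<open>a\<close> at 0 is never inspected, and only
  the initial segment of length \<^term>\<open>k\<close> matters in \<open>segment_fluctuates\<close>.\<close>

definition segment_fluctuates ::
    "real \<Rightarrow> real \<Rightarrow> nat \<Rightarrow> (nat \<Rightarrow> real) \<Rightarrow> nat \<Rightarrow> bool" where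
  "segment_fluctuates \<alpha> \<beta> n a k \<longleftrightarrow>
     (\<exists>i :: nat \<Rightarrow> nat. 1 \<le> i 0 \<and> (\<forall>j<n. i j < i (Suc j)) \<and> i n \<le> k \<and>
        (\<forall>j\<le>n. (odd j \<longrightarrow> a (i j) < \<alpha>) \<and> (even j \<longrightarrow> a (i j) > \<beta>)))"

definition fluctuating :: "real \<Rightarrow> real \<Rightarrow> nat \<Rightarrow> (nat \<Rightarrow> real) set" where
  "fluctuating \<alpha> \<beta> n = {a. \<exists>k. segment_fluctuates \<alpha> \<beta> n a k}"

definition measure_preserving_action ::
    "('g, 'b) monoid_scheme \<Rightarrow> 'x measure \<Rightarrow> ('g \<Rightarrow> 'x \<Rightarrow> 'x) \<Rightarrow> bool" where
  "measure_preserving_action G M \<phi> \<longleftrightarrow>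
     group_action G (space M) \<phi> \<and>
     (\<forall>g\<in>carrier G. \<phi> g \<in> measurable M M \<and> distr M M (\<phi> g) = M)"

definition admissible_constants ::
    "'x itself \<Rightarrow> ('g, 'b) monoid_scheme \<Rightarrow> 'g set \<Rightarrow> real \<Rightarrow> real \<Rightarrow> real \<Rightarrow> real \<Rightarrow> bool" where
  "admissible_constants _ G S \<alpha> \<beta> c1 c2 \<longleftrightarrow>
     0 < c1 \<and> 0 < c2 \<and> c2 < 1 \<and>
     (\<forall>(M :: 'x measure) \<phi> f. prob_space M \<longrightarrow> measure_preserving_action G M \<phi> \<longrightarrow>
        f \<in> borel_measurable M \<longrightarrow> (\<forall>x\<in>space M. 0 \<le> f x) \<longrightarrow>
        (\<forall>N\<ge>1. measure M {x \<in> space M.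
            (\<lambda>k. avg (word_ball G S (real k)) (\<lambda>g. f (\<phi> g x))) \<in> fluctuating \<alpha> \<beta> N}
          < c1 * c2 ^ N))"

text \<open>
  HOL cannot quantify over types inside a formula, so constants bound by an existential in a
  statement about all measures on a type variable could depend on that type.
  \<open>uniform_constants\<close> provides constants that are functions of the group, its generating set and
  the interval only: they are chosen among the constants that are admissible for all systems on
  the single type \<open>'g \<Rightarrow> real\<close>. This type is large enough because every system
  with an observable \<open>f\<close> has the factor \<open>x \<mapsto> (g \<mapsto> f (g x))\<close>, which has the same averages.
\<close>

definition uniform_constants ::
    "('g, 'b) monoid_scheme \<Rightarrow> 'g set \<Rightarrow> real \<Rightarrow> real \<Rightarrow> real \<times> real" where
  "uniform_constants G S \<alpha> \<beta> =
     (SOME (c1, c2). admissible_constants TYPE('g \<Rightarrow> real) G S \<alpha> \<beta> c1 c2)"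

end

theory Submission
  imports Defs
begin

text \<open>The statement is transferred from the measure space to the group. Along the orbit of a point
  \<open>x\<close> the observable becomes the function \<open>F g = f (g x)\<close>, and the average of \<open>f\<close> at \<open>h x\<close> over
  \<open>B(k)\<close> is the average of \<open>F\<close> over \<open>B(k) h\<close>, the ball of radius \<open>k\<close> around \<open>h\<close> in the
  right-invariant word metric. If, for every nonnegative \<open>F\<close>, the set of centres \<open>h \<in> B(K)\<close> at which
  these averages fluctuate \<open>N\<close> times with radii at most \<open>K\<close> has at most
  \<open>c\<^sub>1 c\<^sub>2\<^sup>N |B(2 K)|\<close> elements, then invariance of the measure and doubling bound the measure of the
  points with such a fluctuation by a multiple of \<open>c\<^sub>2\<^sup>N\<close>, uniformly in \<open>K\<close>
  (\<open>measure_average_orbit_bound\<close>, \<open>admissible_constants_exist\<close>).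

  The combinatorial bound (\<open>fluctuation_count_bound\<close>) holds in every geodesic space with integer
  distances whose balls have a doubling cardinality that depends on the radius only. Suppose that
  balls with average above \<open>\<beta>\<close> are disjoint and have total volume \<open>v\<close>, and that larger disjoint
  balls with average below \<open>\<alpha>\<close> swallow almost all of them. As \<open>F \<ge> 0\<close>, the larger balls carry mass
  at least about \<open>\<beta> v\<close>, hence have volume at least about \<open>(\<beta> / \<alpha>) v\<close>. So the volume grows by a fixed
  factor for each passage from above \<open>\<beta>\<close> to below \<open>\<alpha>\<close>, while all the balls stay in one finite set
  \<open>W\<close>; if \<open>A\<close> is the set of initial centres, \<open>|A|\<close> is at most \<open>|W|\<close> divided by an exponential.

  A disjoint subfamily of balls normally covers only a fixed proportion. To cover
  almost everything (\<open>covering_step\<close>), each centre is given \<open>n\<close> radii, each at least \<open>E\<close> times the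
  preceding one, and Vitali's greedy choice is made among all the resulting balls. A small ball
  that is not swallowed either lies near the sphere of a much larger chosen ball, or else, on each
  of its \<open>n\<close> scales, is close to a chosen ball of comparable size; then it lies in the threefold
  enlargements of \<open>n\<close> different chosen balls. The first case is rare because in a doubling geodesic
  space thin shells have small volume (\<open>thin_shells\<close>), the second because the enlargements have total
  volume at most \<open>C\<^sup>2\<close> times that of the chosen balls. The radii required exist because
  \<open>F \<ge> 0\<close> makes the volume of the ball grow by the factor \<open>\<beta> / \<alpha>\<close> at every drop of the average
  (\<open>fluctuation_volume_growth\<close>).

  Finally, the map \<open>x \<mapsto> (g \<mapsto> f (g x))\<close> sends any system to a shift on \<open>'g \<Rightarrow> real\<close>
  with the same averages, so constants that serve the latter type serve all
  (\<open>admissible_constants_transfer\<close>).\<close>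

section \<open>Disjoint balls in doubling geodesic spaces\<close>

text \<open>Vitali's selection: take a set of maximal \<open>rad\<close>, discard all the sets that meet it, and repeat.\<close>

lemma greedy_disjoint_subfamily:
  fixes rad :: "'i \<Rightarrow> nat" and B :: "'i \<Rightarrow> 'a set"
  assumes "finite I" "\<And>i. i \<in> I \<Longrightarrow> B i \<noteq> {}"
  shows "\<exists>J\<subseteq>I. disjoint_family_on B J \<and> (\<forall>i\<in>I. \<exists>j\<in>J. B i \<inter> B j \<noteq> {} \<and> rad i \<le> rad j)"
  using assms
proof (induction "card I" arbitrary: I rule: less_induct)
  case less
  show ?case
  proof (cases "I = {}")
    case True
    then show ?thesis by (auto simp: disjoint_family_on_def)
  next
    case False
    have "Max (rad ` I) \<in> rad ` I" using less.prems False by simp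
    then obtain i0 where i0: "i0 \<in> I" "rad i0 = Max (rad ` I)" by auto
    have max: "rad i \<le> rad i0" if "i \<in> I" for i using i0 that less.prems by simp
    define I' where "I' = {i \<in> I. B i \<inter> B i0 = {}}"
    have "i0 \<notin> I'" using less.prems i0 by (auto simp: I'_def)
    then have "I' \<subset> I" using i0 by (auto simp: I'_def)
    then have "card I' < card I" using less.prems by (simp add: psubset_card_mono)
    moreover have "finite I'" "\<And>i. i \<in> I' \<Longrightarrow> B i \<noteq> {}" using less.prems by (auto simp: I'_def)
    ultimately obtain J where J: "J \<subseteq> I'" "disjoint_family_on B J"
      "\<forall>i\<in>I'. \<exists>j\<in>J. B i \<inter> B j \<noteq> {} \<and> rad i \<le> rad j"
      using less.hyps[of I'] by blast
    have "disjoint_family_on B (insert i0 J)"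
      using J(1,2) by (auto simp: disjoint_family_on_def I'_def)
    moreover have "\<exists>j\<in>insert i0 J. B i \<inter> B j \<noteq> {} \<and> rad i \<le> rad j" if "i \<in> I" for i
      using J(3) max that by (cases "i \<in> I'") (auto simp: I'_def)
    moreover have "insert i0 J \<subseteq> I" using J(1) i0 by (auto simp: I'_def)
    ultimately show ?thesis by blast
  qed
qed

lemma tower_mono:
  fixes \<rho> :: "nat \<Rightarrow> nat"
  assumes "0 < E" "\<And>u. u < L \<Longrightarrow> E * \<rho> u \<le> \<rho> (Suc u)" "u \<le> v" "v \<le> L"
  shows "\<rho> u \<le> \<rho> v"
  using assms(3,4)
proof (induction v rule: dec_induct)
  case (step m)
  have "\<rho> m \<le> E * \<rho> m" using assms(1) by simp
  also have "\<dots> \<le> \<rho> (Suc m)" using assms(2) step.prems by simp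
  finally show ?case using step by simp
qed simp

text \<open>The properties of a group with a word metric that the covering argument uses: distances are
  natural numbers, and geodesics exist, so an annulus can be compared with the one just inside it.\<close>
locale doubling_geodesic =
  fixes X :: "'a set" and D :: "'a \<Rightarrow> 'a \<Rightarrow> nat" and b :: "nat \<Rightarrow> nat" and C :: real
  assumes nonempty: "X \<noteq> {}"
    and dist_zero: "\<And>x y. x \<in> X \<Longrightarrow> y \<in> X \<Longrightarrow> D x y = 0 \<longleftrightarrow> x = y"
    and dist_sym: "\<And>x y. x \<in> X \<Longrightarrow> y \<in> X \<Longrightarrow> D x y = D y x"
    and dist_tri: "\<And>x y z. x \<in> X \<Longrightarrow> y \<in> X \<Longrightarrow> z \<in> X \<Longrightarrow> D x z \<le> D x y + D y z"
    and geodesic: "\<And>x y s. x \<in> X \<Longrightarrow> y \<in> X \<Longrightarrow> s \<le> D x y \<Longrightarrow>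
          \<exists>z\<in>X. D x z = s \<and> D z y = D x y - s"
    and finite_balls: "\<And>x r. x \<in> X \<Longrightarrow> finite {y \<in> X. D x y \<le> r}"
    and card_balls: "\<And>x r. x \<in> X \<Longrightarrow> card {y \<in> X. D x y \<le> r} = b r"
    and doubling: "\<And>r. real (b (2 * r)) \<le> C * real (b r)"
begin

definition dball :: "'a \<Rightarrow> nat \<Rightarrow> 'a set" where
  "dball x r = {y \<in> X. D x y \<le> r}"

lemma finite_dball [simp]: "x \<in> X \<Longrightarrow> finite (dball x r)"
  and card_dball: "x \<in> X \<Longrightarrow> card (dball x r) = b r"
  and dball_subset: "dball x r \<subseteq> X"
  and dball_mono: "r \<le> s \<Longrightarrow> dball x r \<subseteq> dball x s"
  and centre_in_dball: "x \<in> X \<Longrightarrow> x \<in> dball x r"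
  using finite_balls card_balls dist_zero[of x x] by (auto simp: dball_def)

lemma dball_zero: "x \<in> X \<Longrightarrow> dball x 0 = {x}"
  using dist_zero by (auto simp: dball_def)

lemma b_zero: "b 0 = 1"
  using nonempty dball_zero card_dball by (metis all_not_in_conv card_1_singleton_iff One_nat_def)

lemma b_mono: "r \<le> s \<Longrightarrow> b r \<le> b s"
  using nonempty dball_mono card_dball finite_dball by (metis all_not_in_conv card_mono)

lemma b_pos: "0 < b r"
  using b_mono[of 0 r] b_zero by simp

lemma C_ge_1: "1 \<le> C"
  using doubling[of 0] b_zero by simp

lemma doubling_power: "real (b (2 ^ k * r)) \<le> C ^ k * real (b r)"
proof (induction k)
  case (Suc k)
  have "real (b (2 ^ Suc k * r)) \<le> C * real (b (2 ^ k * r))"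
    using doubling[of "2 ^ k * r"] by (simp add: mult.assoc)
  also have "\<dots> \<le> C * (C ^ k * real (b r))"
    using Suc C_ge_1 by (intro mult_left_mono) auto
  finally show ?case by simp
qed simp

text \<open>Moving a point \<open>p\<close> of the annulus \<open>R - s < D x p \<le> R\<close> by \<open>2 s\<close> towards the centre leads to a point
  whose \<open>s\<close>-ball lies in the next annulus \<open>R - 4 s < D x q \<le> R - s\<close> and within \<open>3 s\<close> of \<open>p\<close>.
  Counting the pairs \<open>(p, q)\<close> with \<open>D p q \<le> 3 s\<close> in both orders shows that the next annulus has at
  least \<open>1 / C\<^sup>2\<close> times the size of the given one.\<close>

lemma annulus_growth:
  assumes "4 * s \<le> R"
  shows "(1 + 1 / C\<^sup>2) * (real (b R) - real (b (R - s))) \<le> real (b R) - real (b (R - 4 * s))"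
proof -
  obtain x where x: "x \<in> X" using nonempty by auto
  define Sh where "Sh = dball x R - dball x (R - s)"
  define T where "T = dball x (R - s) - dball x (R - 4 * s)"
  have fin: "finite Sh" "finite T" using x by (auto simp: Sh_def T_def)
  have "card Sh = b R - b (R - s)"
    using x unfolding Sh_def by (subst card_Diff_subset) (auto simp: card_dball dball_mono)
  then have cSh: "real (card Sh) = real (b R) - real (b (R - s))"
    using b_mono[of "R - s" R] by simp
  have "card T = b (R - s) - b (R - 4 * s)"
    using x unfolding T_def by (subst card_Diff_subset) (auto simp: card_dball dball_mono)
  then have cT: "real (card T) = real (b (R - s)) - real (b (R - 4 * s))"
    using b_mono[of "R - 4 * s" "R - s"] by simp
  have many: "b s \<le> card {q \<in> T. D p q \<le> 3 * s}" if p: "p \<in> Sh" for p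
  proof -
    have pX: "p \<in> X" and pR: "D x p \<le> R" "R - s < D x p"
      using p by (auto simp: Sh_def dball_def)
    have "D p x = D x p" using pX x dist_sym by auto
    moreover have "2 * s \<le> D p x" using pR assms calculation by auto
    ultimately obtain p' where p': "p' \<in> X" "D p p' = 2 * s" "D p' x = D x p - 2 * s"
      using geodesic[OF pX x] by metis
    have "dball p' s \<subseteq> {q \<in> T. D p q \<le> 3 * s}"
    proof
      fix q assume "q \<in> dball p' s"
      then have q: "q \<in> X" "D p' q \<le> s" by (auto simp: dball_def)
      have "D p q \<le> 3 * s" using dist_tri[OF pX p'(1) q(1)] p' q by simp
      moreover have "D x q \<le> R - s"
        using dist_tri[OF x p'(1) q(1)] p' q pR assms dist_sym[OF x p'(1)] by simp
      moreover have "R - 4 * s < D x q"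
        using dist_tri[OF x q(1) p'(1)] p' q pR assms dist_sym[OF x p'(1)] dist_sym[OF q(1) p'(1)]
        by simp
      ultimately show "q \<in> {q \<in> T. D p q \<le> 3 * s}" using q by (auto simp: T_def dball_def)
    qed
    then have "card (dball p' s) \<le> card {q \<in> T. D p q \<le> 3 * s}"
      using fin by (intro card_mono) auto
    then show ?thesis using card_dball p' by simp
  qed
  have few: "card {p \<in> Sh. D p q \<le> 3 * s} \<le> b (3 * s)" if q: "q \<in> T" for q
  proof -
    have qX: "q \<in> X" using q by (auto simp: T_def dball_def)
    have "{p \<in> Sh. D p q \<le> 3 * s} \<subseteq> dball q (3 * s)"
      using dist_sym qX by (auto simp: Sh_def dball_def)
    then show ?thesis using card_mono[OF finite_dball[OF qX]] card_dball[OF qX] by metis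
  qed
  have "card Sh * b s \<le> (\<Sum>p\<in>Sh. card {q \<in> T. D p q \<le> 3 * s})"
    using sum_mono[of Sh "\<lambda>_. b s", OF many] by simp
  also have "\<dots> = (\<Sum>p\<in>Sh. \<Sum>q | q \<in> T \<and> D p q \<le> 3 * s. 1)" by simp
  also have "\<dots> = (\<Sum>q\<in>T. \<Sum>p | p \<in> Sh \<and> D p q \<le> 3 * s. 1)"
    by (rule sum.swap_restrict[OF fin])
  also have "\<dots> \<le> (\<Sum>q\<in>T. b (3 * s))"
    using few by (intro sum_mono) simp
  also have "\<dots> = card T * b (3 * s)" by simp
  finally have "real (card Sh) * real (b s) \<le> real (card T) * real (b (3 * s))"
    by (metis of_nat_le_iff of_nat_mult)
  also have "\<dots> \<le> real (card T) * (C\<^sup>2 * real (b s))"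
    using doubling_power[of 2 s] b_mono[of "3 * s" "4 * s"]
    by (intro mult_left_mono) auto
  finally have "real (card Sh) \<le> real (card T) * C\<^sup>2" using b_pos[of s] by simp
  then have "real (card Sh) / C\<^sup>2 \<le> real (card T)"
    using C_ge_1 by (simp add: field_simps)
  then show ?thesis using cSh cT by (simp add: field_simps)
qed

lemma annulus_growth_power:
  assumes "4 ^ k * s \<le> R"
  shows "(1 + 1 / C\<^sup>2) ^ k * (real (b R) - real (b (R - s))) \<le> real (b R) - real (b (R - 4 ^ k * s))"
  using assms
proof (induction k)
  case (Suc k)
  have "(1 + 1 / C\<^sup>2) ^ Suc k * (real (b R) - real (b (R - s)))
      \<le> (1 + 1 / C\<^sup>2) * (real (b R) - real (b (R - 4 ^ k * s)))"
    using Suc by (simp add: mult.assoc mult_left_mono)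
  also have "\<dots> \<le> real (b R) - real (b (R - 4 ^ Suc k * s))"
    using annulus_growth[of "4 ^ k * s" R] Suc.prems by (simp add: mult.assoc)
  finally show ?case .
qed simp

text \<open>A shell of width \<open>s\<close> at radius \<open>R\<close> can be widened by the factor \<open>4\<close> about \<open>k\<close> times before it
  exhausts the ball if \<open>s\<close> is at most \<open>R / 4 ^ k\<close>. Each widening multiplies its size by at least
  \<open>1 + 1 / C\<^sup>2\<close>, so it must have been a small part of the ball.\<close>

lemma thin_shells:
  assumes "0 < \<eta>"
  obtains E where "2 \<le> E"
    "\<And>R. real (b (R + 2 * (R div E))) - real (b (R - 2 * (R div E))) \<le> \<eta> * real (b R)"
proof -
  have "1 < 1 + 1 / C\<^sup>2" using C_ge_1 by simp
  then obtain k where k: "C / \<eta> < (1 + 1 / C\<^sup>2) ^ k" using real_arch_pow by blast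
  define E :: nat where "E = 4 ^ Suc k"
  have "real (b (R + 2 * (R div E))) - real (b (R - 2 * (R div E))) \<le> \<eta> * real (b R)" for R
  proof -
    define t where "t = R div E"
    have Et: "4 ^ k * (4 * t) \<le> R"
      using div_times_less_eq_dividend[of R E] by (simp add: t_def E_def mult_ac)
    have "4 * t \<le> 4 ^ k * (4 * t)" by simp
    then have t: "4 * t \<le> R" using Et by (rule le_trans)
    let ?d = "real (b (R + 2 * t)) - real (b (R - 2 * t))"
    have "(C / \<eta>) * ?d \<le> (1 + 1 / C\<^sup>2) ^ k * ?d"
      using k b_mono[of "R - 2 * t" "R + 2 * t"] by (intro mult_right_mono) auto
    also have "\<dots> \<le> real (b (R + 2 * t))"
      using annulus_growth_power[of k "4 * t" "R + 2 * t"] Et by simp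
    also have "\<dots> \<le> real (b (2 * R))" using t b_mono by simp
    also have "\<dots> \<le> C * real (b R)" by (rule doubling)
    finally have "C * (?d / \<eta>) \<le> C * real (b R)" by simp
    then have "?d / \<eta> \<le> real (b R)" using C_ge_1 by (subst (asm) mult_le_cancel_left_pos) auto
    then show ?thesis using assms by (simp add: t_def field_simps)
  qed
  moreover have "2 \<le> E" by (simp add: E_def)
  ultimately show ?thesis using that by blast
qed

text \<open>Families of balls are sets of pairs of a centre and a radius; in the families below one centre
  may be paired with several radii.\<close>

definition pball :: "'a \<times> nat \<Rightarrow> 'a set" where
  "pball p = dball (fst p) (snd p)"

definition vol :: "('a \<times> nat) set \<Rightarrow> real" where
  "vol P = (\<Sum>p\<in>P. real (b (snd p)))"

definition packing :: "('a \<times> nat) set \<Rightarrow> bool" where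
  "packing P \<longleftrightarrow> finite P \<and> fst ` P \<subseteq> X \<and> disjoint_family_on pball P"

lemma packing_subset: "packing P \<Longrightarrow> Q \<subseteq> P \<Longrightarrow> packing Q"
  by (auto simp: packing_def intro: finite_subset disjoint_family_on_mono)

lemma packing_finite: "packing P \<Longrightarrow> finite P"
  and packing_finite_pball: "packing P \<Longrightarrow> p \<in> P \<Longrightarrow> finite (pball p)"
  and packing_card_pball: "packing P \<Longrightarrow> p \<in> P \<Longrightarrow> card (pball p) = b (snd p)"
  by (auto simp: packing_def pball_def card_dball image_subset_iff)

lemma packing_sum:
  fixes F :: "'a \<Rightarrow> real"
  assumes "packing P"
  shows "sum F (\<Union>p\<in>P. pball p) = (\<Sum>p\<in>P. sum F (pball p))"
  using assms packing_finite_pball[OF assms]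
  by (intro sum.UNION_disjoint) (auto simp: packing_def disjoint_family_on_def)

lemma vol_eq_card:
  assumes "packing P"
  shows "vol P = real (card (\<Union>p\<in>P. pball p))"
proof -
  have "real (card (\<Union>p\<in>P. pball p)) = (\<Sum>p\<in>P. \<Sum>_\<in>pball p. 1)"
    using packing_sum[OF assms, of "\<lambda>_. 1"] by simp
  then show ?thesis using packing_card_pball[OF assms] by (simp add: vol_def)
qed

text \<open>The almost covering with disjoint balls. \<open>V\<close> is Vitali's choice among the balls
  \<open>(h, \<rho> h j)\<close>, \<open>j < n\<close>, and \<open>Q\<close> consists of the balls of \<open>P\<close> that are swallowed by \<open>V\<close>. The ball
  \<open>(h, \<rho> h j)\<close> meets some \<open>v\<^sub>j \<in> V\<close> that is at least as large. If \<open>v\<^sub>j\<close> is larger by the factor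
  \<open>E\<close> for some \<open>j\<close>, then the ball of \<open>P\<close> at \<open>h\<close>, unless it is contained in \<open>v\<^sub>j\<close>, lies in the thin shell
  around the boundary of \<open>v\<^sub>j\<close>; this is the set \<open>S\<close> of the proof. Otherwise the radius of \<open>v\<^sub>j\<close> is
  between \<open>\<rho> h j\<close> and \<open>E * \<rho> h j \<le> \<rho> h (j + 1)\<close> for each \<open>j\<close>, so the \<open>v\<^sub>j\<close> are \<open>n\<close> different balls
  whose threefold enlargements all contain the ball of \<open>P\<close> at \<open>h\<close>. As
  these enlargements have total volume at most \<open>C\<^sup>2 * vol V\<close>, the exceptional set \<open>Z\<close> of such
  balls has volume at most \<open>C\<^sup>2 / n * vol V\<close>.\<close>

lemma covering_step:
  fixes \<rho> :: "'a \<Rightarrow> nat \<Rightarrow> nat"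
  assumes P: "packing P" and n: "0 < n"
    and shell: "\<And>R. real (b (R + 2 * (R div E))) - real (b (R - 2 * (R div E))) \<le> \<eta> * real (b R)"
    and E: "2 \<le> E"
    and start: "\<And>h r. (h, r) \<in> P \<Longrightarrow> r \<le> \<rho> h 0"
    and tower: "\<And>h r j. (h, r) \<in> P \<Longrightarrow> Suc j < n \<Longrightarrow> E * \<rho> h j \<le> \<rho> h (Suc j)"
  obtains V Q where "packing V" "\<And>y R. (y, R) \<in> V \<Longrightarrow> \<exists>j<n. y \<in> fst ` P \<and> R = \<rho> y j"
    "Q \<subseteq> P" "(\<Union>p\<in>Q. pball p) \<subseteq> (\<Union>v\<in>V. pball v)"
    "vol P \<le> vol Q + (\<eta> + C\<^sup>2 / real n) * vol V"
proof -
  define I where "I = (\<lambda>(p, j). (fst p, \<rho> (fst p) j)) ` (P \<times> {..<n})"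
  have finP: "finite P" and PX: "fst ` P \<subseteq> X" using P by (auto simp: packing_def)
  have "finite I" using finP by (simp add: I_def)
  moreover have "pball i \<noteq> {}" if "i \<in> I" for i
    using that PX centre_in_dball by (fastforce simp: I_def pball_def)
  ultimately obtain V where V: "V \<subseteq> I" "disjoint_family_on pball V"
    and meet: "\<forall>i\<in>I. \<exists>j\<in>V. pball i \<inter> pball j \<noteq> {} \<and> snd i \<le> snd j"
    using greedy_disjoint_subfamily[of I pball snd] by blast
  have VI: "\<exists>j<n. y \<in> fst ` P \<and> R = \<rho> y j" if "(y, R) \<in> V" for y R
    using V(1) that by (force simp: I_def)
  have finV: "finite V" using V(1) \<open>finite I\<close> finite_subset by blast
  have VX: "fst ` V \<subseteq> X" using VI PX by fastforce
  have packV: "packing V" using V(2) finV VX by (simp add: packing_def)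
  define Q where "Q = {p \<in> P. pball p \<subseteq> (\<Union>v\<in>V. pball v)}"
  define Sh where "Sh v = dball (fst v) (snd v + 2 * (snd v div E)) - dball (fst v) (snd v - 2 * (snd v div E))"
    for v :: "'a \<times> nat"
  define S where "S = {p \<in> P - Q. pball p \<subseteq> (\<Union>v\<in>V. Sh v)}"
  define Z where "Z = P - Q - S"
  have volP: "vol P = vol Q + vol S + vol Z"
  proof -
    have "P = Q \<union> S \<union> Z" by (auto simp: Q_def S_def Z_def)
    moreover have "Q \<inter> S = {}" "(Q \<union> S) \<inter> Z = {}" by (auto simp: S_def Z_def)
    moreover have "finite Q" "finite S" "finite Z" using finP by (auto simp: Q_def S_def Z_def)
    ultimately show ?thesis by (simp add: vol_def sum.union_disjoint)
  qed
  have volS: "vol S \<le> \<eta> * vol V"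
  proof -
    have packS: "packing S" by (rule packing_subset[OF P]) (auto simp: S_def)
    have finSh: "finite (Sh v)" if "v \<in> V" for v
      using that VX by (auto simp: Sh_def image_subset_iff)
    have cSh: "real (card (Sh v)) \<le> \<eta> * real (b (snd v))" if "v \<in> V" for v
    proof -
      have x: "fst v \<in> X" using that VX by auto
      have "card (Sh v) = b (snd v + 2 * (snd v div E)) - b (snd v - 2 * (snd v div E))"
        unfolding Sh_def using x by (subst card_Diff_subset) (auto simp: card_dball dball_mono)
      then show ?thesis
        using shell[of "snd v"] b_mono[of "snd v - 2 * (snd v div E)" "snd v + 2 * (snd v div E)"] by simp
    qed
    have "vol S = real (card (\<Union>p\<in>S. pball p))" by (rule vol_eq_card[OF packS])
    also have "\<dots> \<le> real (card (\<Union>v\<in>V. Sh v))"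
      using finV finSh by (intro of_nat_mono card_mono) (auto simp: S_def)
    also have "\<dots> \<le> (\<Sum>v\<in>V. real (card (Sh v)))"
      using card_UN_le[OF finV, of Sh] by (metis of_nat_le_iff of_nat_sum)
    also have "\<dots> \<le> (\<Sum>v\<in>V. \<eta> * real (b (snd v)))"
      by (rule sum_mono[OF cSh])
    finally show ?thesis by (simp add: vol_def sum_distrib_left)
  qed
  have multiplicity: "n \<le> card {v \<in> V. z \<in> dball (fst v) (3 * snd v)}"
    if hr: "(h, r) \<in> Z" and z: "z \<in> dball h r" for h r z
  proof -
    have hP: "(h, r) \<in> P" and notQ: "\<not> dball h r \<subseteq> (\<Union>v\<in>V. pball v)"
      and notS: "\<not> dball h r \<subseteq> (\<Union>v\<in>V. Sh v)"
      using hr by (auto simp: Z_def S_def Q_def pball_def)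
    have hX: "h \<in> X" using hP PX by auto
    have Erho: "\<rho> h j \<le> \<rho> h (Suc j)" if "Suc j < n" for j
      using tower[OF hP that] E by (cases E) auto
    have r_le: "r \<le> \<rho> h j" if "j < n" for j
      using that
    proof (induction j)
      case 0 then show ?case using start[OF hP] by simp
    next
      case (Suc j) then show ?case using Erho[of j] by simp
    qed
    have "\<exists>v\<in>V. pball (h, \<rho> h j) \<inter> pball v \<noteq> {} \<and> \<rho> h j \<le> snd v" if "j < n" for j
    proof -
      have "(h, \<rho> h j) \<in> I"
        unfolding I_def using hP that by (intro image_eqI[of _ _ "((h, r), j)"]) auto
      from bspec[OF meet this] show ?thesis by simp
    qed
    then obtain v where v: "\<And>j. j < n \<Longrightarrow> v j \<in> V"
      "\<And>j. j < n \<Longrightarrow> pball (h, \<rho> h j) \<inter> pball (v j) \<noteq> {}" "\<And>j. j < n \<Longrightarrow> \<rho> h j \<le> snd (v j)"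
      by metis
    have dist_hv: "D (fst (v j)) h \<le> snd (v j) + \<rho> h j" if j: "j < n" for j
    proof -
      obtain w where w: "w \<in> X" "D h w \<le> \<rho> h j" "D (fst (v j)) w \<le> snd (v j)"
        using v(2)[OF j] by (auto simp: pball_def dball_def)
      have "fst (v j) \<in> X" using v(1)[OF j] VX by auto
      then show ?thesis using dist_tri[of "fst (v j)" w h] w hX dist_sym[of w h] by simp
    qed
    have upper: "snd (v j) < E * \<rho> h j" if j: "j < n" for j
    proof (rule ccontr)
      let ?y = "fst (v j)" and ?R = "snd (v j)"
      assume "\<not> ?R < E * \<rho> h j"
      then have le: "\<rho> h j \<le> ?R div E" using E by (simp add: less_eq_div_iff_mult_less_eq mult.commute)
      have yX: "?y \<in> X" using v(1)[OF j] VX by auto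
      obtain w where w: "w \<in> X" "D h w \<le> r" "?R < D ?y w"
        using notQ v(1)[OF j] unfolding pball_def dball_def by (auto simp: subset_iff not_le)
      have "dball h r \<subseteq> Sh (v j)"
      proof
        fix q assume "q \<in> dball h r"
        then have q: "q \<in> X" "D h q \<le> r" by (auto simp: dball_def)
        have "D ?y q \<le> ?R + 2 * (?R div E)"
          using dist_tri[OF yX hX q(1)] dist_hv[OF j] q r_le[OF j] le by simp
        moreover have "?R < D ?y q + 2 * (?R div E)"
          using dist_tri[OF yX q(1) w(1)] dist_tri[OF q(1) hX w(1)] dist_sym[OF q(1) hX] q w r_le[OF j] le
          by simp
        moreover have "2 * (?R div E) \<le> ?R"
        by (rule order_trans[OF mult_le_mono1[OF E] times_div_less_eq_dividend])
      ultimately show "q \<in> Sh (v j)" using q by (auto simp: Sh_def dball_def)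
      qed
      then show False using notS v(1)[OF j] by blast
    qed
    have increasing: "snd (v i) < snd (v (i + k))" if "0 < k" "i + k < n" for i k
      using that
    proof (induction k)
      case (Suc k)
      have "snd (v (i + k)) < snd (v (i + Suc k))"
        using upper[of "i + k"] tower[OF hP, of "i + k"] v(3)[of "i + Suc k"] Suc.prems by simp
      then show ?case using Suc by (cases "k = 0") auto
    qed simp
    have "inj_on v {..<n}"
    proof (rule linorder_inj_onI')
      fix i j assume "i \<in> {..<n}" "j \<in> {..<n}" "i < j"
      then show "v i \<noteq> v j" using increasing[of "j - i" i] by auto
    qed
    then have "n = card (v ` {..<n})" by (simp add: card_image)
    also have "\<dots> \<le> card {v \<in> V. z \<in> dball (fst v) (3 * snd v)}"
    proof (rule card_mono)
      show "finite {v \<in> V. z \<in> dball (fst v) (3 * snd v)}" using finV by simp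
      have "z \<in> dball (fst (v j)) (3 * snd (v j))" if j: "j < n" for j
      proof -
        have zX: "z \<in> X" "D h z \<le> r" using z by (auto simp: dball_def)
        have "fst (v j) \<in> X" using v(1)[OF j] VX by auto
        then show ?thesis
          using dist_tri[of "fst (v j)" h z] zX hX dist_hv[OF j] v(3)[OF j] r_le[OF j]
          by (simp add: dball_def)
      qed
      then show "v ` {..<n} \<subseteq> {v \<in> V. z \<in> dball (fst v) (3 * snd v)}" using v(1) by auto
    qed
    finally show ?thesis .
  qed
  have volZ: "vol Z \<le> C\<^sup>2 / real n * vol V"
  proof -
    define U where "U = (\<Union>p\<in>Z. pball p)"
    have packZ: "packing Z" by (rule packing_subset[OF P]) (auto simp: Z_def)
    have finU: "finite U" using packing_finite[OF packZ] packing_finite_pball[OF packZ] by (auto simp: U_def)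
    have "real n * real (card U) = (\<Sum>z\<in>U. real n)" by simp
    also have "\<dots> \<le> (\<Sum>z\<in>U. real (card {v \<in> V. z \<in> dball (fst v) (3 * snd v)}))"
      using multiplicity by (intro sum_mono of_nat_mono) (force simp: U_def pball_def)
    also have "\<dots> = (\<Sum>z\<in>U. \<Sum>v | v \<in> V \<and> z \<in> dball (fst v) (3 * snd v). 1)" by simp
    also have "\<dots> = (\<Sum>v\<in>V. \<Sum>z | z \<in> U \<and> z \<in> dball (fst v) (3 * snd v). 1)"
      by (rule sum.swap_restrict[OF finU finV])
    also have "\<dots> \<le> (\<Sum>v\<in>V. C\<^sup>2 * real (b (snd v)))"
    proof (rule sum_mono)
      fix v assume "v \<in> V"
      then have x: "fst v \<in> X" using VX by auto
      have "card {z \<in> U. z \<in> dball (fst v) (3 * snd v)} \<le> b (3 * snd v)"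
        using card_mono[OF finite_dball[OF x], of _ "3 * snd v"] card_dball[OF x] by (metis (no_types, lifting) mem_Collect_eq subsetI)
      also have "\<dots> \<le> b (4 * snd v)" by (rule b_mono) simp
      finally have "real (card {z \<in> U. z \<in> dball (fst v) (3 * snd v)}) \<le> real (b (4 * snd v))" by simp
      also have "\<dots> \<le> C\<^sup>2 * real (b (snd v))" using doubling_power[of 2 "snd v"] by simp
      finally show "(\<Sum>z | z \<in> U \<and> z \<in> dball (fst v) (3 * snd v). 1) \<le> C\<^sup>2 * real (b (snd v))" by simp
    qed
    also have "\<dots> = C\<^sup>2 * vol V" by (simp add: vol_def sum_distrib_left)
    finally have "real n * vol Z \<le> C\<^sup>2 * vol V" using vol_eq_card[OF packZ] by (simp add: U_def)
    then show ?thesis using n by (simp add: field_simps)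
  qed
  show ?thesis
  proof (rule that[OF packV VI, of Q])
    show "Q \<subseteq> P" "(\<Union>p\<in>Q. pball p) \<subseteq> (\<Union>v\<in>V. pball v)" by (auto simp: Q_def)
    show "vol P \<le> vol Q + (\<eta> + C\<^sup>2 / real n) * vol V" using volP volS volZ by (simp add: distrib_right)
  qed
qed

section \<open>Growth of volume along a fluctuation\<close>

text \<open>One passage from high to low averages. The balls of \<open>P\<close> are first covered by balls with average
  at least \<open>\<beta>\<close>, then these by balls with average at most \<open>\<alpha>\<close>. The first covering loses at most the
  factor \<open>1 + \<kappa>\<close> of volume. In the second, the mass of \<open>F\<close> on the swallowed balls is at least
  \<open>\<beta>\<close> times their volume and at most \<open>\<alpha>\<close> times the volume of the new balls.\<close>

lemma two_block_growth:
  fixes F :: "'a \<Rightarrow> real" and \<rho> :: "'a \<Rightarrow> nat \<Rightarrow> nat"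
  assumes n: "0 < n" and E: "2 \<le> E" and \<eta>: "0 \<le> \<eta>" and pos: "0 < \<alpha>" "0 < \<beta>"
    and shell: "\<And>R. real (b (R + 2 * (R div E))) - real (b (R - 2 * (R div E))) \<le> \<eta> * real (b R)"
    and F: "\<And>x. x \<in> X \<Longrightarrow> 0 \<le> F x"
    and P: "packing P" "fst ` P \<subseteq> A"
    and start: "\<And>h r. (h, r) \<in> P \<Longrightarrow> r \<le> \<rho> h 0"
    and tower: "\<And>h u. h \<in> A \<Longrightarrow> u < 2 * n \<Longrightarrow> E * \<rho> h u \<le> \<rho> h (Suc u)"
    and high: "\<And>h u. h \<in> A \<Longrightarrow> u < n \<Longrightarrow> \<beta> * real (b (\<rho> h u)) \<le> sum F (dball h (\<rho> h u))"
    and low: "\<And>h u. h \<in> A \<Longrightarrow> n \<le> u \<Longrightarrow> u < 2 * n \<Longrightarrow>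
        sum F (dball h (\<rho> h u)) \<le> \<alpha> * real (b (\<rho> h u))"
  defines "\<kappa> \<equiv> \<eta> + C\<^sup>2 / real n"
  obtains P' where "packing P'" "fst ` P' \<subseteq> A" "\<And>h r. (h, r) \<in> P' \<Longrightarrow> r \<le> \<rho> h (2 * n)"
    "vol P \<le> (1 + \<kappa>) * (\<alpha> / \<beta> + \<kappa>) * vol P'"
proof -
  have \<kappa>: "0 \<le> \<kappa>" using \<eta> by (simp add: \<kappa>_def)
  have mono: "\<rho> h u \<le> \<rho> h v" if "h \<in> A" "u \<le> v" "v \<le> 2 * n" for h u v
    using tower_mono[of E "2 * n" "\<rho> h" u v] tower that E by simp
  obtain V Q where V: "packing V" "\<And>y R. (y, R) \<in> V \<Longrightarrow> \<exists>j<n. y \<in> fst ` P \<and> R = \<rho> y j"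
    and Q: "Q \<subseteq> P" "(\<Union>p\<in>Q. pball p) \<subseteq> (\<Union>v\<in>V. pball v)"
    and volP: "vol P \<le> vol Q + \<kappa> * vol V"
  proof (rule covering_step[OF P(1) n shell E, of \<rho>])
    show "r \<le> \<rho> h 0" if "(h, r) \<in> P" for h r using start that .
    show "E * \<rho> h j \<le> \<rho> h (Suc j)" if "(h, r) \<in> P" "Suc j < n" for h r j
      using that P(2) tower[of h j] by force
  qed (auto simp: \<kappa>_def)
  have VA: "fst ` V \<subseteq> A" using V(2) P(2) by fastforce
  have finite_cover: "finite (\<Union>v\<in>W. pball v)" if "packing W" for W
    using packing_finite[OF that] packing_finite_pball[OF that] by auto
  have "vol Q \<le> vol V"
    using vol_eq_card[OF packing_subset[OF P(1) Q(1)]] vol_eq_card[OF V(1)] card_mono[OF finite_cover[OF V(1)] Q(2)]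
    by simp
  then have 1: "vol P \<le> (1 + \<kappa>) * vol V" using volP by (simp add: distrib_right)
  obtain V' Q' where V': "packing V'" "\<And>y R. (y, R) \<in> V' \<Longrightarrow> \<exists>j<n. y \<in> fst ` V \<and> R = \<rho> y (n + j)"
    and Q': "Q' \<subseteq> V" "(\<Union>p\<in>Q'. pball p) \<subseteq> (\<Union>v\<in>V'. pball v)"
    and volV: "vol V \<le> vol Q' + \<kappa> * vol V'"
  proof (rule covering_step[OF V(1) n shell E, of "\<lambda>h j. \<rho> h (n + j)"])
    show "r \<le> \<rho> h (n + 0)" if "(h, r) \<in> V" for h r
      using V(2)[OF that] VA that mono[of h _ n] by force
    show "E * \<rho> h (n + j) \<le> \<rho> h (n + Suc j)" if "(h, r) \<in> V" "Suc j < n" for h r j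
      using that VA tower[of h "n + j"] by force
  qed (auto simp: \<kappa>_def)
  have V'A: "fst ` V' \<subseteq> A" using V'(2) VA by fastforce
  have "\<beta> * vol Q' = (\<Sum>p\<in>Q'. \<beta> * real (b (snd p)))" by (simp add: vol_def sum_distrib_left)
  also have "\<dots> \<le> (\<Sum>p\<in>Q'. sum F (pball p))"
  proof (rule sum_mono)
    fix p assume "p \<in> Q'"
    then have p: "(fst p, snd p) \<in> V" using Q' by auto
    then obtain j where "j < n" "snd p = \<rho> (fst p) j" using V(2) by blast
    moreover have "fst p \<in> A" using p VA by force
    ultimately show "\<beta> * real (b (snd p)) \<le> sum F (pball p)"
      using high[of "fst p" j] by (simp add: pball_def)
  qed
  also have "\<dots> = sum F (\<Union>p\<in>Q'. pball p)" using packing_sum[OF packing_subset[OF V(1) Q'(1)]] by simp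
  also have "\<dots> \<le> sum F (\<Union>v\<in>V'. pball v)"
    using finite_cover[OF V'(1)] Q'(2) F by (intro sum_mono2) (auto simp: pball_def dball_def)
  also have "\<dots> = (\<Sum>v\<in>V'. sum F (pball v))" using packing_sum[OF V'(1)] .
  also have "\<dots> \<le> (\<Sum>v\<in>V'. \<alpha> * real (b (snd v)))"
  proof (rule sum_mono)
    fix v assume v: "v \<in> V'"
    then obtain j where "j < n" "snd v = \<rho> (fst v) (n + j)" using V'(2)[of "fst v" "snd v"] by auto
    moreover have "fst v \<in> A" using v V'A by auto
    ultimately show "sum F (pball v) \<le> \<alpha> * real (b (snd v))"
      using low[of "fst v" "n + j"] by (simp add: pball_def)
  qed
  also have "\<dots> = \<alpha> * vol V'" by (simp add: vol_def sum_distrib_left)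
  finally have "vol Q' \<le> \<alpha> / \<beta> * vol V'" using pos by (simp add: field_simps)
  then have "vol V \<le> (\<alpha> / \<beta> + \<kappa>) * vol V'" using volV by (simp add: distrib_right)
  then have "(1 + \<kappa>) * vol V \<le> (1 + \<kappa>) * ((\<alpha> / \<beta> + \<kappa>) * vol V')"
    using \<kappa> by (intro mult_left_mono) auto
  then have vol: "vol P \<le> (1 + \<kappa>) * (\<alpha> / \<beta> + \<kappa>) * vol V'" using 1 by (simp add: mult.assoc)
  have "r \<le> \<rho> h (2 * n)" if hr: "(h, r) \<in> V'" for h r
  proof -
    obtain j where "j < n" "r = \<rho> h (n + j)" using V'(2)[OF hr] by auto
    moreover have "h \<in> A" using hr V'A by force
    ultimately show ?thesis using mono[of h "n + j" "2 * n"] by simp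
  qed
  then show ?thesis using that V'(1) V'A vol by blast
qed

text \<open>The induction starts from balls of radius \<open>0\<close> at the points of \<open>A\<close>, whose volume is \<open>card A\<close>, and
  uses \<open>2 n\<close> radii of each tower for each of the \<open>T\<close> passages.\<close>

lemma alternating_tower_bound:
  fixes F :: "'a \<Rightarrow> real" and \<rho> :: "'a \<Rightarrow> nat \<Rightarrow> nat"
  assumes n: "0 < n" and E: "2 \<le> E" and \<eta>: "0 \<le> \<eta>" and pos: "0 < \<alpha>" "0 < \<beta>"
    and shell: "\<And>R. real (b (R + 2 * (R div E))) - real (b (R - 2 * (R div E))) \<le> \<eta> * real (b R)"
    and F: "\<And>x. x \<in> X \<Longrightarrow> 0 \<le> F x"
    and A: "A \<subseteq> X" "finite A"
    and tower: "\<And>h u. h \<in> A \<Longrightarrow> u < 2 * n * T \<Longrightarrow> E * \<rho> h u \<le> \<rho> h (Suc u)"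
    and high: "\<And>h u. h \<in> A \<Longrightarrow> u < 2 * n * T \<Longrightarrow> even (u div n) \<Longrightarrow>
        \<beta> * real (b (\<rho> h u)) \<le> sum F (dball h (\<rho> h u))"
    and low: "\<And>h u. h \<in> A \<Longrightarrow> u < 2 * n * T \<Longrightarrow> odd (u div n) \<Longrightarrow>
        sum F (dball h (\<rho> h u)) \<le> \<alpha> * real (b (\<rho> h u))"
    and W: "finite W" "\<And>h. h \<in> A \<Longrightarrow> dball h (\<rho> h (2 * n * T)) \<subseteq> W"
  shows "real (card A) \<le> ((1 + (\<eta> + C\<^sup>2 / real n)) * (\<alpha> / \<beta> + (\<eta> + C\<^sup>2 / real n))) ^ T * real (card W)"
proof -
  define \<kappa> where "\<kappa> = \<eta> + C\<^sup>2 / real n"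
  define q where "q = (1 + \<kappa>) * (\<alpha> / \<beta> + \<kappa>)"
  have q: "0 \<le> q" using \<eta> pos by (simp add: q_def \<kappa>_def)
  have "\<exists>P. packing P \<and> fst ` P \<subseteq> A \<and> (\<forall>h r. (h, r) \<in> P \<longrightarrow> r \<le> \<rho> h (2 * n * t)) \<and>
      real (card A) \<le> q ^ t * vol P" if "t \<le> T" for t
    using that
  proof (induction t)
    case 0
    define P where "P = (\<lambda>h. (h, 0::nat)) ` A"
    have "packing P" using A
      by (auto simp: P_def packing_def disjoint_family_on_def pball_def dball_zero subset_iff)
    moreover have "vol P = real (card A)"
      by (simp add: vol_def P_def sum.reindex inj_on_def b_zero)
    moreover have "fst ` P \<subseteq> A" "\<forall>h r. (h, r) \<in> P \<longrightarrow> r \<le> \<rho> h (2 * n * 0)" by (auto simp: P_def)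
    ultimately show ?case by (intro exI[of _ P]) auto
  next
    case (Suc t)
    from Suc.IH[OF Suc_leD[OF Suc.prems]]
    obtain P where P: "packing P" "fst ` P \<subseteq> A" "\<And>h r. (h, r) \<in> P \<Longrightarrow> r \<le> \<rho> h (2 * n * t)"
      and card: "real (card A) \<le> q ^ t * vol P" by blast
    have "2 * n * t + 2 * n = 2 * n * Suc t" by simp
    also have "\<dots> \<le> 2 * n * T" using Suc.prems by (intro mult_le_mono2)
    finally have le: "2 * n * t + 2 * n \<le> 2 * n * T" .
    have div: "(2 * n * t + u) div n = 2 * t + u div n" for u
      using n by (simp add: mult.commute mult.left_commute)
    obtain P' where P': "packing P'" "fst ` P' \<subseteq> A" "\<And>h r. (h, r) \<in> P' \<Longrightarrow> r \<le> \<rho> h (2 * n * t + 2 * n)"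
      and vol: "vol P \<le> (1 + (\<eta> + C\<^sup>2 / real n)) * (\<alpha> / \<beta> + (\<eta> + C\<^sup>2 / real n)) * vol P'"
    proof (rule two_block_growth[where \<rho> = "\<lambda>h u. \<rho> h (2 * n * t + u)", OF n E \<eta> pos shell F P(1,2)])
      show "r \<le> \<rho> h (2 * n * t + 0)" if "(h, r) \<in> P" for h r using P(3) that by simp
      show "E * \<rho> h (2 * n * t + u) \<le> \<rho> h (2 * n * t + Suc u)" if "h \<in> A" "u < 2 * n" for h u
        using tower[of h "2 * n * t + u"] that le by simp
      show "\<beta> * real (b (\<rho> h (2 * n * t + u))) \<le> sum F (dball h (\<rho> h (2 * n * t + u)))"
        if "h \<in> A" "u < n" for h u
        using high[of h "2 * n * t + u"] that le by (simp add: div)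
      show "sum F (dball h (\<rho> h (2 * n * t + u))) \<le> \<alpha> * real (b (\<rho> h (2 * n * t + u)))"
        if "h \<in> A" "n \<le> u" "u < 2 * n" for h u
      proof -
        have "u div n = 1" using that by (intro div_nat_eqI) auto
        then show ?thesis using low[of h "2 * n * t + u"] that le by (simp add: div)
      qed
    qed auto
    have "q ^ t * vol P \<le> q ^ t * (q * vol P')"
      using vol q unfolding q_def \<kappa>_def by (intro mult_left_mono) auto
    then have "real (card A) \<le> q ^ Suc t * vol P'" using card by (simp add: mult_ac)
    moreover have "r \<le> \<rho> h (2 * n * Suc t)" if "(h, r) \<in> P'" for h r
      using P'(3)[OF that] by (simp add: add.commute)
    ultimately show ?case using P'(1,2) by (intro exI[of _ P']) auto
  qed
  from this[OF order_refl]
  obtain P where P: "packing P" "fst ` P \<subseteq> A" "\<And>h r. (h, r) \<in> P \<Longrightarrow> r \<le> \<rho> h (2 * n * T)"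
    and card: "real (card A) \<le> q ^ T * vol P" by blast
  have "(\<Union>p\<in>P. pball p) \<subseteq> W"
  proof
    fix z assume "z \<in> (\<Union>p\<in>P. pball p)"
    then obtain h r where hr: "(h, r) \<in> P" "z \<in> dball h r" by (auto simp: pball_def)
    moreover have "h \<in> A" using hr P(2) by force
    ultimately show "z \<in> W" using W(2) P(3) dball_mono by blast
  qed
  then have "vol P \<le> real (card W)" using vol_eq_card[OF P(1)] W(1) by (simp add: card_mono)
  then have "q ^ T * vol P \<le> q ^ T * real (card W)" using q by (intro mult_left_mono) auto
  then show ?thesis using card by (simp add: q_def \<kappa>_def)
qed

text \<open>When the average drops from \<open>\<beta>\<close> or more to \<open>\<alpha>\<close> or less, the mass of \<open>F\<close> in the ball has not
  decreased, so the volume has grown at least by the factor \<open>\<beta> / \<alpha>\<close>. Any \<open>2 p\<close> consecutive steps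
  contain \<open>p\<close> such drops, wherever they begin.\<close>

lemma fluctuation_volume_growth:
  fixes F :: "'a \<Rightarrow> real" and i :: "nat \<Rightarrow> nat"
  assumes F: "\<And>x. x \<in> X \<Longrightarrow> 0 \<le> F x" and h: "h \<in> X" and pos: "0 < \<alpha>" "0 < \<beta>"
    and incr: "\<And>j. j < N \<Longrightarrow> i j < i (Suc j)"
    and low: "\<And>j. j \<le> N \<Longrightarrow> odd j \<Longrightarrow> sum F (dball h (i j)) \<le> \<alpha> * real (b (i j))"
    and high: "\<And>j. j \<le> N \<Longrightarrow> even j \<Longrightarrow> \<beta> * real (b (i j)) \<le> sum F (dball h (i j))"
    and "l + 2 * p \<le> N"
  shows "(\<beta> / \<alpha>) ^ p * real (b (i l)) \<le> real (b (i (l + 2 * p)))"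
  using assms(8)
proof (induction p)
  case (Suc p)
  have pair: "\<beta> / \<alpha> * real (b (i j)) \<le> real (b (i (Suc j)))" if "even j" "j < N" for j
  proof -
    have "\<beta> * real (b (i j)) \<le> sum F (dball h (i j))" using high that by simp
    also have "\<dots> \<le> sum F (dball h (i (Suc j)))"
      using h F incr[OF that(2)] dball_mono[of "i j" "i (Suc j)" h]
      by (intro sum_mono2) (auto dest: subsetD[OF dball_subset])
    also have "\<dots> \<le> \<alpha> * real (b (i (Suc j)))" using low that by simp
    finally show ?thesis using pos by (simp add: field_simps)
  qed
  have two: "\<beta> / \<alpha> * real (b (i j)) \<le> real (b (i (j + 2)))" if j: "j + 2 \<le> N" for j
  proof (cases "even j")
    case True
    have "b (i (Suc j)) \<le> b (i (j + 2))" using incr[of "Suc j"] j by (intro b_mono) simp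
    then show ?thesis using pair[OF True] j by simp
  next
    case False
    have "b (i j) \<le> b (i (Suc j))" using incr[of j] j by (intro b_mono) simp
    then have "\<beta> / \<alpha> * real (b (i j)) \<le> \<beta> / \<alpha> * real (b (i (Suc j)))"
      using pos by (intro mult_left_mono) auto
    then show ?thesis using pair[of "Suc j"] False j by simp
  qed
  have "(\<beta> / \<alpha>) ^ Suc p * real (b (i l)) = \<beta> / \<alpha> * ((\<beta> / \<alpha>) ^ p * real (b (i l)))" by simp
  also have "\<dots> \<le> \<beta> / \<alpha> * real (b (i (l + 2 * p)))"
    using Suc pos by (intro mult_left_mono) auto
  also have "\<dots> \<le> real (b (i (l + 2 * Suc p)))" using two[of "l + 2 * p"] Suc.prems by simp
  finally show ?case .
qed simp

text \<open>By doubling, a volume growth beyond \<open>C ^ E\<close> forces the radius to grow by the factor \<open>E\<close>. So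
  towers are obtained from a fluctuation by keeping only every \<open>(2 p + 2)\<close>-th radius.\<close>

lemma fluctuation_tower:
  fixes F :: "'a \<Rightarrow> real"
  assumes F: "\<And>x. x \<in> X \<Longrightarrow> 0 \<le> F x" and h: "h \<in> X" and pos: "0 < \<alpha>" "0 < \<beta>"
    and fluct: "segment_fluctuates \<alpha> \<beta> N (\<lambda>k. sum F (dball h k) / real (b k)) K"
    and p: "C ^ E < (\<beta> / \<alpha>) ^ p" and n: "0 < n"
    and N: "2 * n * T * (2 * p + 2) \<le> N"
  obtains \<rho> where "\<And>u. u < 2 * n * T \<Longrightarrow> E * \<rho> u \<le> \<rho> (Suc u)"
    "\<And>u. u < 2 * n * T \<Longrightarrow> even (u div n) \<Longrightarrow> \<beta> * real (b (\<rho> u)) \<le> sum F (dball h (\<rho> u))"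
    "\<And>u. u < 2 * n * T \<Longrightarrow> odd (u div n) \<Longrightarrow> sum F (dball h (\<rho> u)) \<le> \<alpha> * real (b (\<rho> u))"
    "\<rho> (2 * n * T) \<le> K"
proof -
  obtain i where i: "\<forall>j<N. i j < i (Suc j)" "i N \<le> K"
    and lh: "\<forall>j\<le>N. (odd j \<longrightarrow> sum F (dball h (i j)) / real (b (i j)) < \<alpha>) \<and>
        (even j \<longrightarrow> sum F (dball h (i j)) / real (b (i j)) > \<beta>)"
    using fluct unfolding segment_fluctuates_def by blast
  have low: "sum F (dball h (i j)) \<le> \<alpha> * real (b (i j))" if "j \<le> N" "odd j" for j
    using lh that b_pos[of "i j"] by (fastforce simp: field_simps)
  have high: "\<beta> * real (b (i j)) \<le> sum F (dball h (i j))" if "j \<le> N" "even j" for j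
    using lh that b_pos[of "i j"] by (fastforce simp: field_simps)
  have imono: "i j \<le> i k" if "j \<le> k" "k \<le> N" for j k
    using tower_mono[of 1 N i j k] that i(1) by (simp add: less_imp_le)
  have gap: "E * i j \<le> i k" if "j + 2 * p \<le> k" "k \<le> N" for j k
  proof (rule ccontr)
    assume "\<not> E * i j \<le> i k"
    then have "i k \<le> E * i j" by simp
    also have "\<dots> \<le> 2 ^ E * i j" by (intro mult_le_mono1) (simp add: less_imp_le)
    finally have "real (b (i k)) \<le> real (b (2 ^ E * i j))" by (intro of_nat_mono b_mono)
    also have "\<dots> \<le> C ^ E * real (b (i j))" by (rule doubling_power)
    also have "\<dots> < (\<beta> / \<alpha>) ^ p * real (b (i j))" using p b_pos[of "i j"] by simp
    also have "\<dots> \<le> real (b (i (j + 2 * p)))"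
      using fluctuation_volume_growth[of F h \<alpha> \<beta> N i j p] F h pos i(1) low high that by simp
    also have "\<dots> \<le> real (b (i k))" using that by (intro of_nat_mono b_mono imono)
    finally show False by simp
  qed
  define m where "m = 2 * p + 2"
  \<comment> \<open>As \<open>m\<close> is even, the summand \<open>(u div n) mod 2\<close> makes the blocks of \<open>n\<close> radii alternate between
    high and low averages. It shortens a gap by at most one, and \<open>m\<close> exceeds \<open>2 * p\<close> by two.\<close>
  define idx where "idx u = u * m + (u div n) mod 2" for u
  have idx_le: "idx u \<le> N" if "u \<le> 2 * n * T" for u
  proof (cases "u = 2 * n * T")
    case True
    have "u div n = 2 * T" using n True by (simp add: mult.commute mult.left_commute)
    then show ?thesis using N True by (simp add: idx_def m_def)
  next
    case False
    then have "Suc u \<le> 2 * n * T" using that by simp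
    then have "Suc u * m \<le> N" using N mult_le_mono1[of "Suc u" "2 * n * T" m] by (simp add: m_def)
    moreover have "(u div n) mod 2 \<le> 1" by simp
    ultimately show ?thesis by (simp add: idx_def m_def)
  qed
  have parity: "even (idx u) \<longleftrightarrow> even (u div n)" for u by (simp add: idx_def m_def)
  show ?thesis
  proof (rule that[of "\<lambda>u. i (idx u)"])
    fix u assume u: "u < 2 * n * T"
    have "(u div n) mod 2 \<le> 1" by simp
    then have "idx u + 2 * p \<le> idx (Suc u)" by (simp add: idx_def m_def)
    then show "E * i (idx u) \<le> i (idx (Suc u))" using gap idx_le[of "Suc u"] u by simp
    show "\<beta> * real (b (i (idx u))) \<le> sum F (dball h (i (idx u)))" if "even (u div n)"
      using high[of "idx u"] idx_le[of u] parity[of u] u that by simp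
    show "sum F (dball h (i (idx u))) \<le> \<alpha> * real (b (i (idx u)))" if "odd (u div n)"
      using low[of "idx u"] idx_le[of u] parity[of u] u that by simp
  next
    show "i (idx (2 * n * T)) \<le> K" using imono[of "idx (2 * n * T)" N] idx_le[of "2 * n * T"] i(2) by simp
  qed
qed

text \<open>With \<open>\<kappa> \<le> (1 - \<alpha> / \<beta>) / 4\<close> the loss in the two coverings is smaller than the gain \<open>\<beta> / \<alpha>\<close>, so
  each passage, which costs \<open>L\<close> fluctuations, multiplies the bound by some \<open>q < 1\<close>; hence the rate
  \<open>c2 = root L q\<close>. The constant \<open>1 / q\<close> pays for rounding \<open>N\<close> down to a multiple of \<open>L\<close>.\<close>

theorem fluctuation_count_bound:
  assumes "0 < \<alpha>" "\<alpha> < \<beta>"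
  obtains c1 c2 :: real where "0 < c1" "0 < c2" "c2 < 1"
    "\<And>(F :: 'a \<Rightarrow> real) A W K N. (\<And>x. x \<in> X \<Longrightarrow> 0 \<le> F x) \<Longrightarrow> A \<subseteq> X \<Longrightarrow> finite W \<Longrightarrow>
       (\<And>h. h \<in> A \<Longrightarrow> dball h K \<subseteq> W) \<Longrightarrow>
       (\<And>h. h \<in> A \<Longrightarrow> segment_fluctuates \<alpha> \<beta> N (\<lambda>k. sum F (dball h k) / real (b k)) K) \<Longrightarrow>
       real (card A) \<le> c1 * c2 ^ N * real (card W)"
proof -
  have pos: "0 < \<alpha>" "0 < \<beta>" using assms by auto
  define \<theta> where "\<theta> = \<alpha> / \<beta>"
  have \<theta>: "0 < \<theta>" "\<theta> < 1" using assms by (auto simp: \<theta>_def)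
  define \<delta> where "\<delta> = (1 - \<theta>) / 4"
  have \<delta>: "0 < \<delta>" "\<delta> \<le> 1" using \<theta> by (auto simp: \<delta>_def)
  obtain E where E: "2 \<le> E"
    and shell: "\<And>R. real (b (R + 2 * (R div E))) - real (b (R - 2 * (R div E))) \<le> \<delta> / 2 * real (b R)"
    using thin_shells[of "\<delta> / 2"] \<delta> by (metis half_gt_zero)
  obtain n :: nat where n_large: "C\<^sup>2 / (\<delta> / 2) < real n" using reals_Archimedean2 by blast
  moreover have "0 \<le> C\<^sup>2 / (\<delta> / 2)" using \<delta> by simp
  ultimately have "0 < real n" by linarith
  then have n: "0 < n" "C\<^sup>2 / real n \<le> \<delta> / 2" using n_large \<delta> by (simp_all add: field_simps)
  have "1 < \<beta> / \<alpha>" using assms by simp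
  then obtain p where p: "C ^ E < (\<beta> / \<alpha>) ^ p" using real_arch_pow by blast
  define \<kappa> where "\<kappa> = \<delta> / 2 + C\<^sup>2 / real n"
  define q where "q = (1 + \<kappa>) * (\<theta> + \<kappa>)"
  have "\<kappa> \<le> \<delta> / 2 + \<delta> / 2" unfolding \<kappa>_def using n(2) by (rule add_left_mono)
  then have \<kappa>: "0 < \<kappa>" "\<kappa> \<le> \<delta>" using \<delta> by (auto simp: \<kappa>_def add_pos_nonneg)
  have q0: "0 < q" using \<kappa> \<theta> by (simp add: q_def)
  have "q \<le> (1 + \<delta>) * (\<theta> + \<delta>)" unfolding q_def using \<kappa> \<theta> \<delta> by (intro mult_mono) auto
  also have "\<dots> = 1 - (1 - \<theta>) * (11 - 3 * \<theta>) / 16"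
    by (simp add: \<delta>_def field_simps power2_eq_square)
  also have "\<dots> < 1" using mult_pos_pos[of "1 - \<theta>" "11 - 3 * \<theta>"] \<theta> by simp
  finally have q1: "q < 1" .
  define L where "L = 2 * n * (2 * p + 2)"
  have L: "0 < L" using n by (simp add: L_def)
  define c2 where "c2 = root L q"
  have c2: "0 < c2" "c2 < 1" using q0 q1 L by (simp_all add: c2_def)
  have pow: "c2 ^ L = q" using q0 L by (simp add: c2_def)
  have "real (card A) \<le> 1 / q * c2 ^ N * real (card W)"
    if F: "\<And>x. x \<in> X \<Longrightarrow> 0 \<le> F x" and A: "A \<subseteq> X" and W: "finite W"
      and AW: "\<And>h. h \<in> A \<Longrightarrow> dball h K \<subseteq> W"
      and fl: "\<And>h. h \<in> A \<Longrightarrow> segment_fluctuates \<alpha> \<beta> N (\<lambda>k. sum F (dball h k) / real (b k)) K"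
    for F :: "'a \<Rightarrow> real" and A W K N
  proof -
    define T where "T = N div L"
    have "2 * n * T * (2 * p + 2) = T * L" unfolding L_def by (simp only: mult_ac)
    also have "\<dots> \<le> N" unfolding T_def by (rule div_times_less_eq_dividend)
    finally have N: "2 * n * T * (2 * p + 2) \<le> N" .
    have "\<exists>\<rho>. (\<forall>u<2 * n * T. E * \<rho> u \<le> \<rho> (Suc u)) \<and>
      (\<forall>u<2 * n * T. even (u div n) \<longrightarrow> \<beta> * real (b (\<rho> u)) \<le> sum F (dball h (\<rho> u))) \<and>
      (\<forall>u<2 * n * T. odd (u div n) \<longrightarrow> sum F (dball h (\<rho> u)) \<le> \<alpha> * real (b (\<rho> u))) \<and>
      \<rho> (2 * n * T) \<le> K" if "h \<in> A" for h
    proof -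
      have "h \<in> X" using A that by auto
      from fluctuation_tower[OF F this pos fl[OF that] p n(1) N] show ?thesis by metis
    qed
    then obtain \<rho> where \<rho>: "\<And>h. h \<in> A \<Longrightarrow> (\<forall>u<2 * n * T. E * \<rho> h u \<le> \<rho> h (Suc u)) \<and>
      (\<forall>u<2 * n * T. even (u div n) \<longrightarrow> \<beta> * real (b (\<rho> h u)) \<le> sum F (dball h (\<rho> h u))) \<and>
      (\<forall>u<2 * n * T. odd (u div n) \<longrightarrow> sum F (dball h (\<rho> h u)) \<le> \<alpha> * real (b (\<rho> h u))) \<and>
      \<rho> h (2 * n * T) \<le> K" by metis
    have "A \<subseteq> W" using AW A centre_in_dball by blast
    then have finA: "finite A" using W finite_subset by blast
    have "real (card A) \<le> ((1 + (\<delta> / 2 + C\<^sup>2 / real n)) * (\<alpha> / \<beta> + (\<delta> / 2 + C\<^sup>2 / real n))) ^ T * real (card W)"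
    proof (rule alternating_tower_bound[where \<rho> = \<rho> and F = F, OF n(1) E _ pos shell F A finA _ _ _ W])
      show "0 \<le> \<delta> / 2" using \<delta> by simp
      show "E * \<rho> h u \<le> \<rho> h (Suc u)" if "h \<in> A" "u < 2 * n * T" for h u
        using \<rho>[OF that(1)] that(2) by blast
      show "\<beta> * real (b (\<rho> h u)) \<le> sum F (dball h (\<rho> h u))"
        if "h \<in> A" "u < 2 * n * T" "even (u div n)" for h u
        using \<rho>[OF that(1)] that(2,3) by blast
      show "sum F (dball h (\<rho> h u)) \<le> \<alpha> * real (b (\<rho> h u))"
        if "h \<in> A" "u < 2 * n * T" "odd (u div n)" for h u
        using \<rho>[OF that(1)] that(2,3) by blast
      show "dball h (\<rho> h (2 * n * T)) \<subseteq> W" if "h \<in> A" for h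
        using \<rho>[OF that] AW[OF that] dball_mono[of "\<rho> h (2 * n * T)" K h] by blast
    qed
    then have "real (card A) \<le> q ^ T * real (card W)" by (simp add: q_def \<kappa>_def \<theta>_def)
    also have "q ^ T = c2 ^ (L * T)" using pow by (simp add: power_mult)
    also have "\<dots> \<le> 1 / q * c2 ^ N"
    proof -
      have "N \<le> L * T + L" using mod_less_divisor[OF L, of N] mult_div_mod_eq[of L N] unfolding T_def by linarith
      then have "c2 ^ (L * T + L) \<le> c2 ^ N" using c2 by (intro power_decreasing) auto
      then show ?thesis using q0 pow by (simp add: power_add field_simps)
    qed
    finally show ?thesis by (simp add: mult_right_mono)
  qed
  moreover have "0 < 1 / q" using q0 by simp
  ultimately show ?thesis using that c2 by blast
qed

end

section \<open>The word metric of a finitely generated group\<close>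

locale word_metric = group G for G :: "('g, 'b) monoid_scheme" (structure) +
  fixes S :: "'g set"
  assumes generating: "generating_set G S"
begin

abbreviation words :: "('g \<times> int) list set" where
  "words \<equiv> {w. set w \<subseteq> S \<times> UNIV}"

abbreviation norm_w :: "'g \<Rightarrow> nat" ("\<parallel>_\<parallel>") where
  "\<parallel>g\<parallel> \<equiv> word_norm G S g"

lemma generators_closed: "s \<in> S \<Longrightarrow> s \<in> carrier G"
  using generating by (auto simp: generating_set_def)

lemma word_value_Nil [simp]: "word_value G [] = \<one>"
  and word_value_Cons [simp]: "word_value G ((s, p) # w) = s [^] p \<otimes> word_value G w"
  and word_cost_Nil [simp]: "word_cost [] = 0"
  and word_cost_Cons [simp]: "word_cost ((s, p) # w) = nat \<bar>p\<bar> + word_cost w"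
  and word_cost_append [simp]: "word_cost (v @ w) = word_cost v + word_cost w"
  by (simp_all add: word_value_def word_cost_def)

lemma word_value_closed [simp]: "w \<in> words \<Longrightarrow> word_value G w \<in> carrier G"
  by (induction w) (auto simp: generators_closed)

lemma word_value_append:
  "v \<in> words \<Longrightarrow> w \<in> words \<Longrightarrow> word_value G (v @ w) = word_value G v \<otimes> word_value G w"
  by (induction v) (auto simp: m_assoc generators_closed)

lemma inverse_word:
  "w \<in> words \<Longrightarrow> \<exists>w'\<in>words. word_value G w' = inv (word_value G w) \<and> word_cost w' = word_cost w"
proof (induction w)
  case (Cons a w)
  obtain s p where a: "a = (s, p)" by (cases a)
  have s: "s \<in> carrier G" "s \<in> S" using Cons.prems a generators_closed by auto
  obtain w' where w': "w' \<in> words" "word_value G w' = inv (word_value G w)" "word_cost w' = word_cost w"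
    using Cons by auto
  have "word_value G (w' @ [(s, - p)]) = inv (word_value G (a # w))"
    using w' s a Cons.prems by (subst word_value_append) (auto simp: int_pow_neg inv_mult_group)
  then show ?case using w' s a by (intro bexI[of _ "w' @ [(s, - p)]"]) auto
next
  case Nil
  show ?case by (rule bexI[of _ "[]"]) auto
qed

lemma exists_word:
  assumes "g \<in> carrier G"
  shows "\<exists>w\<in>words. g = word_value G w"
proof -
  have "g \<in> generate G S" using assms generating by (simp add: generating_set_def)
  then show ?thesis
  proof induction
    case one
    then show ?case by (intro bexI[of _ "[]"]) auto
  next
    case (incl h)
    then show ?case using generators_closed by (intro bexI[of _ "[(h, 1)]"]) auto
  next
    case (inv h)
    then show ?case using generators_closed
      by (intro bexI[of _ "[(h, - 1)]"]) (auto simp: int_pow_neg)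
  next
    case (eng h1 h2)
    then obtain w1 w2 where "w1 \<in> words" "w2 \<in> words" "h1 = word_value G w1" "h2 = word_value G w2"
      by blast
    then show ?case by (intro bexI[of _ "w1 @ w2"]) (auto simp: word_value_append)
  qed
qed

lemma word_norm_le: "w \<in> words \<Longrightarrow> \<parallel>word_value G w\<parallel> \<le> word_cost w"
  unfolding word_norm_def by (intro wellorder_Inf_le1) auto

lemma optimal_word:
  assumes "g \<in> carrier G"
  obtains w where "w \<in> words" "g = word_value G w" "word_cost w = \<parallel>g\<parallel>"
proof -
  let ?K = "{word_cost w |w. set w \<subseteq> S \<times> UNIV \<and> g = word_value G w}"
  have "?K \<noteq> {}" using exists_word[OF assms] by auto
  then have "\<parallel>g\<parallel> \<in> ?K" unfolding word_norm_def by (rule Inf_nat_def1)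
  then show ?thesis using that by auto
qed

lemma word_norm_mult:
  assumes "g \<in> carrier G" "h \<in> carrier G"
  shows "\<parallel>g \<otimes> h\<parallel> \<le> \<parallel>g\<parallel> + \<parallel>h\<parallel>"
proof -
  obtain v w where "v \<in> words" "g = word_value G v" "word_cost v = \<parallel>g\<parallel>"
    "w \<in> words" "h = word_value G w" "word_cost w = \<parallel>h\<parallel>"
    using optimal_word assms by metis
  then show ?thesis using word_norm_le[of "v @ w"] by (simp add: word_value_append)
qed

lemma word_norm_inv:
  assumes "g \<in> carrier G"
  shows "\<parallel>inv g\<parallel> = \<parallel>g\<parallel>"
proof -
  have le: "\<parallel>inv g\<parallel> \<le> \<parallel>g\<parallel>" if "g \<in> carrier G" for g
  proof -
    obtain w where w: "w \<in> words" "g = word_value G w" "word_cost w = \<parallel>g\<parallel>"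
      using optimal_word[OF \<open>g \<in> carrier G\<close>] by metis
    obtain w' where "w' \<in> words" "word_value G w' = inv g" "word_cost w' = \<parallel>g\<parallel>"
      using inverse_word[OF w(1)] w by auto
    then show ?thesis using word_norm_le[of w'] by simp
  qed
  show ?thesis using le[OF assms] le[of "inv g"] assms by simp
qed

lemma word_norm_eq_0_iff:
  assumes "g \<in> carrier G"
  shows "\<parallel>g\<parallel> = 0 \<longleftrightarrow> g = \<one>"
proof
  assume "\<parallel>g\<parallel> = 0"
  then obtain w where "w \<in> words" "g = word_value G w" "word_cost w = 0"
    using optimal_word[OF assms] by metis
  moreover have "word_value G w = \<one>" if "w \<in> words" "word_cost w = 0" for w
    using that by (induction w) (auto simp: generators_closed)
  ultimately show "g = \<one>" by simp
next
  assume "g = \<one>"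
  then show "\<parallel>g\<parallel> = 0" using word_norm_le[of "[]"] by simp
qed

text \<open>Geodesics in the word metric come from cutting a word after the first \<open>s\<close> letters; the cut may
  fall inside a power of a generator, which is then divided into two powers of the same sign.\<close>

lemma split_word:
  "w \<in> words \<Longrightarrow> s \<le> word_cost w \<Longrightarrow>
    \<exists>u\<in>words. \<exists>v\<in>words. word_value G w = word_value G u \<otimes> word_value G v \<and>
      word_cost u = s \<and> word_cost v = word_cost w - s"
proof (induction w arbitrary: s)
  case (Cons a w)
  obtain x p where a: "a = (x, p)" by (cases a)
  have x: "x \<in> carrier G" "x \<in> S" and w: "w \<in> words" using Cons.prems a generators_closed by auto
  show ?case
  proof (cases "s \<le> nat \<bar>p\<bar>")
    case True
    define p1 where "p1 = (if 0 \<le> p then int s else - int s)"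
    have p1: "nat \<bar>p1\<bar> = s" "nat \<bar>p - p1\<bar> = nat \<bar>p\<bar> - s" using True by (auto simp: p1_def)
    have "x [^] p = x [^] p1 \<otimes> x [^] (p - p1)" using int_pow_mult[OF x(1), of p1 "p - p1"] by simp
    then have "word_value G (a # w) = word_value G [(x, p1)] \<otimes> word_value G ((x, p - p1) # w)"
      using a x w by (simp add: m_assoc)
    then show ?thesis
      by - (rule bexI[of _ "[(x, p1)]"], rule bexI[of _ "(x, p - p1) # w"], use a x w p1 True in auto)
  next
    case False
    then have "s - nat \<bar>p\<bar> \<le> word_cost w" using Cons.prems a by simp
    then obtain u v where uv: "u \<in> words" "v \<in> words" "word_value G w = word_value G u \<otimes> word_value G v"
      "word_cost u = s - nat \<bar>p\<bar>" "word_cost v = word_cost w - (s - nat \<bar>p\<bar>)"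
      using Cons.IH[OF w] by blast
    have "word_value G (a # w) = word_value G (a # u) \<otimes> word_value G v"
      using uv a x by (simp add: m_assoc)
    then show ?thesis
      by - (rule bexI[of _ "a # u"], rule bexI[of _ v], use uv a x False in \<open>auto simp: add.commute\<close>)
  qed
next
  case Nil
  then show ?case by (intro bexI[of _ "[]"]) auto
qed

lemma word_norm_split:
  assumes "g \<in> carrier G" "s \<le> \<parallel>g\<parallel>"
  obtains u v where "u \<in> carrier G" "v \<in> carrier G" "g = u \<otimes> v" "\<parallel>u\<parallel> = s" "\<parallel>v\<parallel> = \<parallel>g\<parallel> - s"
proof -
  obtain w where w: "w \<in> words" "g = word_value G w" "word_cost w = \<parallel>g\<parallel>"
    using optimal_word[OF assms(1)] by metis
  obtain u v where uv: "u \<in> words" "v \<in> words" "g = word_value G u \<otimes> word_value G v"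
    "word_cost u = s" "word_cost v = \<parallel>g\<parallel> - s"
    using split_word[OF w(1), of s] w assms(2) by auto
  have "\<parallel>g\<parallel> \<le> \<parallel>word_value G u\<parallel> + \<parallel>word_value G v\<parallel>" using uv word_norm_mult by simp
  moreover have "\<parallel>word_value G u\<parallel> \<le> s" "\<parallel>word_value G v\<parallel> \<le> \<parallel>g\<parallel> - s" using word_norm_le uv by metis+
  ultimately have "\<parallel>word_value G u\<parallel> = s" "\<parallel>word_value G v\<parallel> = \<parallel>g\<parallel> - s" using assms(2) by linarith+
  then show ?thesis using that uv word_value_closed by blast
qed

text \<open>The right-invariant distance, for which the balls are the right translates of the word balls:
  averaging \<open>f\<close> over \<open>B(k)\<close> at the point \<open>h x\<close> involves the elements of \<open>B(k) h\<close>.\<close>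
definition right_dist :: "'g \<Rightarrow> 'g \<Rightarrow> nat" where
  "right_dist g h = \<parallel>g \<otimes> inv h\<parallel>"

lemma right_dist_sym:
  assumes "g \<in> carrier G" "h \<in> carrier G"
  shows "right_dist g h = right_dist h g"
  using word_norm_inv[of "g \<otimes> inv h"] assms by (simp add: right_dist_def inv_mult_group)

lemma right_ball:
  assumes "x \<in> carrier G"
  shows "{y \<in> carrier G. right_dist x y \<le> r} = (\<lambda>g. g \<otimes> x) ` word_ball G S (real r)"
proof -
  have "{y \<in> carrier G. right_dist x y \<le> r} = {y \<in> carrier G. \<parallel>y \<otimes> inv x\<parallel> \<le> r}"
    using right_dist_sym[OF assms] by (auto simp: right_dist_def)
  also have "\<dots> = (\<lambda>g. g \<otimes> x) ` word_ball G S (real r)"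
  proof (intro equalityI subsetI)
    fix y assume "y \<in> {y \<in> carrier G. \<parallel>y \<otimes> inv x\<parallel> \<le> r}"
    then show "y \<in> (\<lambda>g. g \<otimes> x) ` word_ball G S (real r)"
      using assms by (intro image_eqI[of _ _ "y \<otimes> inv x"]) (auto simp: word_ball_def m_assoc)
  next
    fix y assume "y \<in> (\<lambda>g. g \<otimes> x) ` word_ball G S (real r)"
    then show "y \<in> {y \<in> carrier G. \<parallel>y \<otimes> inv x\<parallel> \<le> r}"
      using assms by (auto simp: word_ball_def m_assoc)
  qed
  finally show ?thesis .
qed

lemma inj_on_right_mult: "x \<in> carrier G \<Longrightarrow> inj_on (\<lambda>g. g \<otimes> x) (word_ball G S r)"
  by (auto simp: inj_on_def word_ball_def)

lemma word_ball_0: "word_ball G S 0 = {\<one>}"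
  using word_norm_eq_0_iff by (auto simp: word_ball_def)

text \<open>Finiteness of the balls is read off from the lower bound on their cardinality, since infinite
  sets have cardinality \<open>0\<close>.\<close>

lemma growth_doubling:
  assumes "growth_degree G S d"
  obtains C where "\<And>r::nat. real (growth G S (real (2 * r))) \<le> C * real (growth G S (real r))"
    "\<And>r::nat. finite (word_ball G S (real r))"
proof -
  obtain C where C: "0 < C" "\<And>n::nat. 1 \<le> n \<Longrightarrow> 1 / C * real n ^ d \<le> real (growth G S (real n))"
     "\<And>n::nat. 1 \<le> n \<Longrightarrow> real (growth G S (real n)) \<le> C * real n ^ d"
    using assms by (auto simp: growth_degree_def)
  define C' where "C' = max 1 (C\<^sup>2 * 2 ^ d)"
  have "real (growth G S (real (2 * r))) \<le> C' * real (growth G S (real r))" for r :: nat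
  proof (cases "r = 0")
    case True
    then show ?thesis by (simp add: growth_def word_ball_0 C'_def)
  next
    case False
    have "real (growth G S (real (2 * r))) \<le> C * real (2 * r) ^ d"
      using C(3)[of "2 * r"] False by simp
    also have "\<dots> = C\<^sup>2 * 2 ^ d * (1 / C * real r ^ d)"
      using C(1) by (simp add: power_mult_distrib power2_eq_square)
    also have "\<dots> \<le> C\<^sup>2 * 2 ^ d * real (growth G S (real r))"
      using C(2)[of r] False by (intro mult_left_mono) auto
    also have "\<dots> \<le> C' * real (growth G S (real r))"
      by (intro mult_right_mono) (auto simp: C'_def)
    finally show ?thesis .
  qed
  moreover have "finite (word_ball G S (real r))" for r :: nat
  proof (cases "r = 0")
    case True
    then show ?thesis by (simp add: word_ball_0)
  next
    case False
    then have "0 < 1 / C * real r ^ d" using C(1) by simp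
    also have "\<dots> \<le> real (growth G S (real r))" using C(2) False by simp
    finally show ?thesis by (auto simp: growth_def intro: card_ge_0_finite)
  qed
  ultimately show ?thesis using that by blast
qed

lemma doubling_geodesic_word_metric:
  assumes "\<And>r::nat. real (growth G S (real (2 * r))) \<le> C * real (growth G S (real r))"
    and "\<And>r::nat. finite (word_ball G S (real r))"
  shows "doubling_geodesic (carrier G) right_dist (\<lambda>r. growth G S (real r)) C"
proof
  show "carrier G \<noteq> {}" by auto
  fix x y assume x: "x \<in> carrier G"
  {
    assume y: "y \<in> carrier G"
    have "right_dist x y = 0 \<longleftrightarrow> x \<otimes> inv y = \<one>"
      using x y by (simp add: right_dist_def word_norm_eq_0_iff)
    also have "\<dots> \<longleftrightarrow> x = y" using x y by (metis inv_closed inv_equality inv_inv r_inv)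
    finally show "right_dist x y = 0 \<longleftrightarrow> x = y" .
    show "right_dist x y = right_dist y x" using x y by (rule right_dist_sym)
    {
      fix z assume z: "z \<in> carrier G"
      have "x \<otimes> inv z = (x \<otimes> inv y) \<otimes> (y \<otimes> inv z)"
        using x y z by (simp add: m_assoc inv_solve_left)
      then show "right_dist x z \<le> right_dist x y + right_dist y z"
        using x y z word_norm_mult by (simp add: right_dist_def)
    }
    {
      fix s assume "s \<le> right_dist x y"
      then obtain u v where uv: "u \<in> carrier G" "v \<in> carrier G" "x \<otimes> inv y = u \<otimes> v" "\<parallel>u\<parallel> = s"
        "\<parallel>v\<parallel> = right_dist x y - s"
        using word_norm_split[of "x \<otimes> inv y" s] x y by (auto simp: right_dist_def)
      have "x \<otimes> inv (v \<otimes> y) = (x \<otimes> inv y) \<otimes> inv v"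
        using x y uv(1,2) by (simp add: inv_mult_group m_assoc)
      also have "\<dots> = u" unfolding uv(3) using uv(1,2) by (simp add: m_assoc)
      finally have "right_dist x (v \<otimes> y) = s" using uv by (simp add: right_dist_def)
      moreover have "right_dist (v \<otimes> y) y = right_dist x y - s"
        using uv y by (simp add: right_dist_def m_assoc)
      ultimately show "\<exists>z\<in>carrier G. right_dist x z = s \<and> right_dist z y = right_dist x y - s"
        using uv y by (intro bexI[of _ "v \<otimes> y"]) auto
    }
  }
  fix r
  show "finite {y \<in> carrier G. right_dist x y \<le> r}"
    using assms(2) by (simp add: right_ball[OF x])
  show "card {y \<in> carrier G. right_dist x y \<le> r} = growth G S (real r)"
    by (simp add: right_ball[OF x] card_image inj_on_right_mult[OF x] growth_def)
qed (use assms in auto)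

end

section \<open>Transference to measure-preserving actions\<close>

text \<open>Lists of indices are countable, which makes the existential quantifier measurable.\<close>

lemma segment_fluctuates_iff_list:
  "segment_fluctuates \<alpha> \<beta> N a K \<longleftrightarrow>
    (\<exists>l :: nat list. 1 \<le> l ! 0 \<and> (\<forall>j<N. l ! j < l ! Suc j) \<and> l ! N \<le> K \<and>
       (\<forall>j\<le>N. (odd j \<longrightarrow> a (l ! j) < \<alpha>) \<and> (even j \<longrightarrow> a (l ! j) > \<beta>)))"
proof
  assume "segment_fluctuates \<alpha> \<beta> N a K"
  then obtain i where i: "1 \<le> i 0" "\<forall>j<N. i j < i (Suc j)" "i N \<le> K"
     "\<forall>j\<le>N. (odd j \<longrightarrow> a (i j) < \<alpha>) \<and> (even j \<longrightarrow> a (i j) > \<beta>)"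
    unfolding segment_fluctuates_def by blast
  have "map i [0..<Suc N] ! j = i j" if "j \<le> N" for j using that by (simp del: upt_Suc)
  then show "\<exists>l :: nat list. 1 \<le> l ! 0 \<and> (\<forall>j<N. l ! j < l ! Suc j) \<and> l ! N \<le> K \<and>
       (\<forall>j\<le>N. (odd j \<longrightarrow> a (l ! j) < \<alpha>) \<and> (even j \<longrightarrow> a (l ! j) > \<beta>))"
    using i by (intro exI[of _ "map i [0..<Suc N]"]) (simp del: upt_Suc)
next
  assume "\<exists>l :: nat list. 1 \<le> l ! 0 \<and> (\<forall>j<N. l ! j < l ! Suc j) \<and> l ! N \<le> K \<and>
       (\<forall>j\<le>N. (odd j \<longrightarrow> a (l ! j) < \<alpha>) \<and> (even j \<longrightarrow> a (l ! j) > \<beta>))"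
  then obtain l :: "nat list" where "1 \<le> l ! 0 \<and> (\<forall>j<N. l ! j < l ! Suc j) \<and> l ! N \<le> K \<and>
       (\<forall>j\<le>N. (odd j \<longrightarrow> a (l ! j) < \<alpha>) \<and> (even j \<longrightarrow> a (l ! j) > \<beta>))" by blast
  then show "segment_fluctuates \<alpha> \<beta> N a K"
    unfolding segment_fluctuates_def by (intro exI[of _ "\<lambda>j. l ! j"]) simp
qed

lemma segment_fluctuates_measurable:
  assumes [measurable]: "\<And>k. (\<lambda>x. a x k) \<in> borel_measurable M"
  shows "{x \<in> space M. segment_fluctuates \<alpha> \<beta> N (a x) K} \<in> sets M"
  unfolding segment_fluctuates_iff_list by measurable

lemma segment_fluctuates_mono:
  "segment_fluctuates \<alpha> \<beta> N a K \<Longrightarrow> \<alpha> \<le> \<alpha>' \<Longrightarrow> K \<le> K' \<Longrightarrow> segment_fluctuates \<alpha>' \<beta> N a K'"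
  unfolding segment_fluctuates_def by (meson order_less_le_trans order_trans)

lemma fluctuating_measurable:
  assumes [measurable]: "\<And>k. (\<lambda>x. a x k) \<in> borel_measurable M"
  shows "{x \<in> space M. a x \<in> fluctuating \<alpha> \<beta> N} \<in> sets M"
proof -
  have "{x \<in> space M. a x \<in> fluctuating \<alpha> \<beta> N} =
      (\<Union>K. {x \<in> space M. segment_fluctuates \<alpha> \<beta> N (a x) K})"
    by (auto simp: fluctuating_def)
  then show ?thesis using segment_fluctuates_measurable[OF assms] by auto
qed

lemma (in doubling_geodesic) ball_in_double_ball:
  assumes "x \<in> X" "h \<in> dball x K"
  shows "dball h K \<subseteq> dball x (2 * K)"
proof
  fix z assume "z \<in> dball h K"
  then have "z \<in> X" "D h z \<le> K" "h \<in> X" "D x h \<le> K" using assms by (auto simp: dball_def)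
  then show "z \<in> dball x (2 * K)" using dist_tri[of x h z] assms(1) by (simp add: dball_def)
qed

text \<open>Transference: the functions \<open>x \<mapsto> indicator E (h x)\<close> all have the integral \<open>measure M E\<close>, and their
  sum over \<open>B\<close> counts the \<open>h \<in> B\<close> with \<open>h x \<in> E\<close>.\<close>

lemma measure_average_orbit_bound:
  fixes M :: "'x measure" and \<phi> :: "'g \<Rightarrow> 'x \<Rightarrow> 'x"
  assumes "prob_space M" and act: "measure_preserving_action G M \<phi>"
    and B: "finite B" "B \<noteq> {}" "B \<subseteq> carrier G" and E: "E \<in> sets M"
    and count: "\<And>x. x \<in> space M \<Longrightarrow> real (card {h \<in> B. \<phi> h x \<in> E}) \<le> c * real (card B)"
  shows "measure M E \<le> c"
proof -
  interpret prob_space M by fact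
  have meas: "\<phi> h \<in> measurable M M" and pres: "distr M M (\<phi> h) = M" if "h \<in> B" for h
    using act B that by (auto simp: measure_preserving_action_def)
  have E_h: "\<phi> h -` E \<inter> space M \<in> sets M" if "h \<in> B" for h
    using measurable_sets[OF meas[OF that] E] .
  let ?f = "\<lambda>x. \<Sum>h\<in>B. indicat_real (\<phi> h -` E \<inter> space M) x"
  have int: "integrable M ?f" using E_h
    by (intro Bochner_Integration.integrable_sum integrable_real_indicator) (auto simp: emeasure_eq_measure)
  have "real (card B) * measure M E = (\<Sum>h\<in>B. measure M E)" by simp
  also have "\<dots> = (\<Sum>h\<in>B. measure M (\<phi> h -` E \<inter> space M))"
  proof (rule sum.cong)
    fix h assume "h \<in> B"
    then show "measure M E = measure M (\<phi> h -` E \<inter> space M)"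
      using measure_distr[OF meas E, of h] pres[of h] by simp
  qed simp
  also have "\<dots> = (\<integral>x. ?f x \<partial>M)"
    using E_h by (subst Bochner_Integration.integral_sum)
      (auto simp: emeasure_eq_measure intro!: integrable_real_indicator)
  also have "\<dots> \<le> c * real (card B)"
  proof (rule integral_le_const[OF int])
    have "?f x \<le> c * real (card B)" if "x \<in> space M" for x
    proof -
      have "?f x = (\<Sum>h\<in>B. if \<phi> h x \<in> E then 1 else 0)"
        using that by (intro sum.cong) (auto simp: indicator_def)
      also have "\<dots> = real (card {h \<in> B. \<phi> h x \<in> E})"
        using B(1) by (simp add: sum.If_cases Int_def)
      finally show ?thesis using count[OF that] by simp
    qed
    then show "AE x in M. ?f x \<le> c * real (card B)" by (intro AE_I2)
  qed
  finally have "real (card B) * measure M E \<le> real (card B) * c" by (simp add: mult.commute)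
  moreover have "0 < real (card B)" using B by (simp add: card_gt_0_iff)
  ultimately show ?thesis by simp
qed

text \<open>The fluctuations with radii up to \<open>K\<close> form an increasing sequence of events \<open>E K\<close>, to each of which
  transference applies with the ball of radius \<open>K\<close>; all the balls involved lie in the ball of radius
  \<open>2 K\<close>, whose size is comparable. The bound does not depend on \<open>K\<close>, hence passes to the limit.\<close>

lemma admissible_constants_exist:
  fixes G :: "('g, 'b) monoid_scheme"
  assumes "group G" "generating_set G S" "growth_degree G S d" "0 \<le> \<alpha>" "\<alpha> < \<beta>"
  shows "\<exists>c1 c2. admissible_constants TYPE('x) G S \<alpha> \<beta> c1 c2"
proof -
  interpret word_metric G S
    using assms(1,2) by (simp add: word_metric_def word_metric_axioms_def)
  obtain C where C: "\<And>r::nat. real (growth G S (real (2 * r))) \<le> C * real (growth G S (real r))"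
    and fin: "\<And>r::nat. finite (word_ball G S (real r))"
    using growth_doubling[OF assms(3)] by blast
  interpret W: doubling_geodesic "carrier G" right_dist "\<lambda>r. growth G S (real r)" C
    using doubling_geodesic_word_metric[OF C fin] .
  \<comment> \<open>\<open>\<alpha> = 0\<close> is possible, whereas the growth factor \<open>\<beta> / \<alpha>\<close> needs a positive lower threshold.\<close>
  define \<alpha>' where "\<alpha>' = (\<alpha> + \<beta>) / 2"
  have \<alpha>': "0 < \<alpha>'" "\<alpha>' < \<beta>" "\<alpha> \<le> \<alpha>'" using assms by (auto simp: \<alpha>'_def)
  obtain c1 c2 :: real where c: "0 < c1" "0 < c2" "c2 < 1" and
    bound: "\<And>(F :: 'g \<Rightarrow> real) A W K N. (\<And>x. x \<in> carrier G \<Longrightarrow> 0 \<le> F x) \<Longrightarrow> A \<subseteq> carrier G \<Longrightarrow> finite W \<Longrightarrow>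
       (\<And>h. h \<in> A \<Longrightarrow> W.dball h K \<subseteq> W) \<Longrightarrow>
       (\<And>h. h \<in> A \<Longrightarrow> segment_fluctuates \<alpha>' \<beta> N
          (\<lambda>k. sum F (W.dball h k) / real (growth G S (real k))) K) \<Longrightarrow>
       real (card A) \<le> c1 * c2 ^ N * real (card W)"
    by (rule W.fluctuation_count_bound[OF \<alpha>'(1,2)]) blast
  have "measure M {x \<in> space M. (\<lambda>k. avg (word_ball G S (real k)) (\<lambda>g. f (\<phi> g x))) \<in> fluctuating \<alpha> \<beta> N}
      < 2 * C * c1 * c2 ^ N"
    if prob: "prob_space M" and act: "measure_preserving_action G M \<phi>"
      and f [measurable]: "f \<in> borel_measurable M" and f0: "\<forall>x\<in>space M. 0 \<le> f x"
    for M :: "'x measure" and \<phi> :: "'g \<Rightarrow> 'x \<Rightarrow> 'x" and f N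
  proof -
    interpret prob_space M by fact
    have ga: "group_action G (space M) \<phi>" using act by (simp add: measure_preserving_action_def)
    have comp: "\<phi> (g \<otimes>\<^bsub>G\<^esub> h) x = \<phi> g (\<phi> h x)"
      if "x \<in> space M" "g \<in> carrier G" "h \<in> carrier G" for g h x
      using group_action.composition_rule[OF ga] that .
    have \<phi>_space: "\<phi> g x \<in> space M" if "x \<in> space M" "g \<in> carrier G" for g x
      using group_action.element_image[OF ga that(2) that(1)] by simp
    define a where "a x k = avg (word_ball G S (real k)) (\<lambda>g. f (\<phi> g x))" for x and k :: nat
    have a_meas: "(\<lambda>x. a x k) \<in> borel_measurable M" for k
    proof -
      have "(\<lambda>x. f (\<phi> g x)) \<in> borel_measurable M" if "g \<in> word_ball G S (real k)" for g
        using act that measurable_compose[OF _ f]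
        by (auto simp: measure_preserving_action_def word_ball_def)
      then show ?thesis unfolding a_def avg_def by (intro borel_measurable_divide borel_measurable_sum) auto
    qed
    define E where "E K = {x \<in> space M. segment_fluctuates \<alpha>' \<beta> N (a x) K}" for K
    have E_sets: "E K \<in> sets M" for K
      unfolding E_def by (rule segment_fluctuates_measurable[OF a_meas])
    have E_bound: "measure M (E K) \<le> C * c1 * c2 ^ N" for K
    proof (rule measure_average_orbit_bound[OF prob act])
      show "finite (W.dball \<one>\<^bsub>G\<^esub> K)" "W.dball \<one>\<^bsub>G\<^esub> K \<noteq> {}" "W.dball \<one>\<^bsub>G\<^esub> K \<subseteq> carrier G"
        using W.centre_in_dball[of "\<one>\<^bsub>G\<^esub>" K] W.dball_subset by auto
      fix x assume x: "x \<in> space M"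
      define F where "F g = f (\<phi> g x)" for g
      define A where "A = {h \<in> W.dball \<one>\<^bsub>G\<^esub> K. \<phi> h x \<in> E K}"
      have A: "A \<subseteq> carrier G" using W.dball_subset by (auto simp: A_def)
      have avg_F: "a (\<phi> h x) k = sum F (W.dball h k) / real (growth G S (real k))" if "h \<in> carrier G" for h k
      proof -
        have "W.dball h k = (\<lambda>g. g \<otimes>\<^bsub>G\<^esub> h) ` word_ball G S (real k)"
          using right_ball[OF that] by (simp add: W.dball_def)
        then have "sum F (W.dball h k) = (\<Sum>g\<in>word_ball G S (real k). F (g \<otimes>\<^bsub>G\<^esub> h))"
          by (simp add: sum.reindex[OF inj_on_right_mult[OF that]])
        also have "\<dots> = (\<Sum>g\<in>word_ball G S (real k). f (\<phi> g (\<phi> h x)))"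
          using comp[OF x _ that] by (intro sum.cong) (auto simp: F_def word_ball_def)
        finally show ?thesis by (simp add: a_def avg_def growth_def)
      qed
      have "real (card A) \<le> c1 * c2 ^ N * real (card (W.dball \<one>\<^bsub>G\<^esub> (2 * K)))"
      proof (rule bound[of F A _ K N])
        show "0 \<le> F g" if "g \<in> carrier G" for g using f0 \<phi>_space[OF x that] by (simp add: F_def)
        show "W.dball h K \<subseteq> W.dball \<one>\<^bsub>G\<^esub> (2 * K)" if "h \<in> A" for h
          using W.ball_in_double_ball[of "\<one>\<^bsub>G\<^esub>" h K] that by (simp add: A_def)
        show "segment_fluctuates \<alpha>' \<beta> N (\<lambda>k. sum F (W.dball h k) / real (growth G S (real k))) K"
          if "h \<in> A" for h
        proof -
          have "segment_fluctuates \<alpha>' \<beta> N (a (\<phi> h x)) K" using that by (simp add: A_def E_def)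
          moreover have "a (\<phi> h x) = (\<lambda>k. sum F (W.dball h k) / real (growth G S (real k)))"
            using avg_F A that by blast
          ultimately show ?thesis by simp
        qed
      qed (use A in auto)
      also have "\<dots> \<le> c1 * c2 ^ N * (C * real (card (W.dball \<one>\<^bsub>G\<^esub> K)))"
        using C[of K] c by (intro mult_left_mono) (auto simp: W.card_dball)
      finally show "real (card {h \<in> W.dball \<one>\<^bsub>G\<^esub> K. \<phi> h x \<in> E K})
          \<le> C * c1 * c2 ^ N * real (card (W.dball \<one>\<^bsub>G\<^esub> K))" by (simp add: A_def mult_ac)
    qed (rule E_sets)
    have "incseq E"
      by (auto simp: incseq_def E_def intro: segment_fluctuates_mono)
    then have "(\<lambda>K. measure M (E K)) \<longlonglongrightarrow> measure M (\<Union>K. E K)"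
      using E_sets by (intro finite_Lim_measure_incseq) auto
    then have lim: "measure M (\<Union>K. E K) \<le> C * c1 * c2 ^ N"
      by (rule LIMSEQ_le_const2) (use E_bound in auto)
    have "{x \<in> space M. a x \<in> fluctuating \<alpha> \<beta> N} \<subseteq> (\<Union>K. E K)"
      using \<alpha>'(3) by (auto simp: fluctuating_def E_def intro: segment_fluctuates_mono)
    then have "measure M {x \<in> space M. a x \<in> fluctuating \<alpha> \<beta> N} \<le> measure M (\<Union>K. E K)"
      using E_sets by (intro finite_measure_mono) auto
    also have "\<dots> \<le> C * c1 * c2 ^ N" by (rule lim)
    also have "\<dots> < 2 * C * c1 * c2 ^ N" using c W.C_ge_1 by simp
    finally show ?thesis by (simp add: a_def[abs_def])
  qed
  then have "admissible_constants TYPE('x) G S \<alpha> \<beta> (2 * C * c1) c2"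
    using c W.C_ge_1 by (auto simp: admissible_constants_def)
  then show ?thesis by blast
qed

section \<open>Independence of the constants from the type of the system\<close>

lemma group_actionI:
  assumes "group G"
    and ext: "\<And>g. g \<in> carrier G \<Longrightarrow> \<phi> g \<in> extensional E"
    and closed: "\<And>g x. g \<in> carrier G \<Longrightarrow> x \<in> E \<Longrightarrow> \<phi> g x \<in> E"
    and one: "\<And>x. x \<in> E \<Longrightarrow> \<phi> \<one>\<^bsub>G\<^esub> x = x"
    and mult: "\<And>g h x. g \<in> carrier G \<Longrightarrow> h \<in> carrier G \<Longrightarrow> x \<in> E \<Longrightarrow> \<phi> (g \<otimes>\<^bsub>G\<^esub> h) x = \<phi> g (\<phi> h x)"
  shows "group_action G E \<phi>"
proof -
  interpret group G by fact
  have Bij: "\<phi> g \<in> Bij E" if g: "g \<in> carrier G" for g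
  proof -
    have "bij_betw (\<phi> g) E E"
      by (rule bij_betw_byWitness[where f' = "\<phi> (inv\<^bsub>G\<^esub> g)"])
        (use g closed one mult[of "inv\<^bsub>G\<^esub> g" g] mult[of g "inv\<^bsub>G\<^esub> g"] in auto)
    then show ?thesis using ext[OF g] by (simp add: Bij_def)
  qed
  have "\<phi> (g \<otimes>\<^bsub>G\<^esub> h) = compose E (\<phi> g) (\<phi> h)" if "g \<in> carrier G" "h \<in> carrier G" for g h
    by (rule extensionalityI[of _ E]) (use that ext mult in \<open>auto simp: compose_def\<close>)
  then have "\<phi> \<in> hom G (BijGroup E)"
    using Bij by (auto simp: hom_def BijGroup_def)
  then show ?thesis
    using group_BijGroup by (simp add: group_action_def group_hom_def group_hom_axioms_def)
qed

text \<open>The map \<open>\<pi>\<close> sends \<open>x\<close> to the function \<open>g \<mapsto> f (g x)\<close>, and intertwines the given action with the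
  right shift \<open>\<psi>\<close>. The image measure is invariant under the shift, and evaluation at the unit
  element plays the part of \<open>f\<close>, so the two systems have the same averages.\<close>

lemma admissible_constants_transfer:
  fixes G :: "('g, 'b) monoid_scheme"
  assumes "group G" and adm: "admissible_constants TYPE('g \<Rightarrow> real) G S \<alpha> \<beta> c1 c2"
  shows "admissible_constants TYPE('x) G S \<alpha> \<beta> c1 c2"
proof -
  interpret group G by fact
  have "measure M {x \<in> space M. (\<lambda>k. avg (word_ball G S (real k)) (\<lambda>g. f (\<phi> g x))) \<in> fluctuating \<alpha> \<beta> N}
      < c1 * c2 ^ N"
    if prob: "prob_space M" and act: "measure_preserving_action G M \<phi>"
      and f [measurable]: "f \<in> borel_measurable M" and f0: "\<forall>x\<in>space M. 0 \<le> f x" and N: "1 \<le> N"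
    for M :: "'x measure" and \<phi> :: "'g \<Rightarrow> 'x \<Rightarrow> 'x" and f and N :: nat
  proof -
    have ga: "group_action G (space M) \<phi>" using act by (simp add: measure_preserving_action_def)
    have comp: "\<phi> (g \<otimes>\<^bsub>G\<^esub> h) x = \<phi> g (\<phi> h x)"
      if "x \<in> space M" "g \<in> carrier G" "h \<in> carrier G" for g h x
      using group_action.composition_rule[OF ga] that .
    have \<phi>_space: "\<phi> g x \<in> space M" if "x \<in> space M" "g \<in> carrier G" for g x
      using group_action.element_image[OF ga that(2) that(1)] by simp
    have \<phi>_meas: "\<phi> g \<in> measurable M M" and \<phi>_pres: "distr M M (\<phi> g) = M" if "g \<in> carrier G" for g
      using act that by (auto simp: measure_preserving_action_def)
    define P :: "('g \<Rightarrow> real) measure" where "P = PiM (carrier G) (\<lambda>_. borel)"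
    have space_P: "space P = PiE (carrier G) (\<lambda>_. UNIV)" by (simp add: P_def space_PiM)
    define \<pi> where "\<pi> x = (\<lambda>g\<in>carrier G. f (\<phi> g x))" for x
    define \<psi> where "\<psi> h = (\<lambda>\<omega>\<in>space P. \<lambda>g\<in>carrier G. \<omega> (g \<otimes>\<^bsub>G\<^esub> h))" for h
    \<comment> \<open>The space of \<open>P\<close> also contains functions with negative values, and the observable must be
      nonnegative everywhere; on the image of \<open>\<pi>\<close> the maximum changes nothing.\<close>
    define f' :: "('g \<Rightarrow> real) \<Rightarrow> real" where "f' \<omega> = max 0 (\<omega> \<one>\<^bsub>G\<^esub>)" for \<omega>
    have \<pi>_meas: "\<pi> \<in> measurable M P"
      unfolding \<pi>_def P_def using measurable_compose[OF \<phi>_meas f] by (intro measurable_restrict)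
    define M' where "M' = distr M P \<pi>"
    have [simp]: "space M' = space P" "sets M' = sets P" by (auto simp: M'_def)
    have coord: "(\<lambda>\<omega>. \<omega> g) \<in> borel_measurable P" if "g \<in> carrier G" for g
      unfolding P_def using that by (rule measurable_component_singleton)
    have \<psi>_meas: "\<psi> h \<in> measurable P P" if h: "h \<in> carrier G" for h
    proof -
      have "(\<lambda>\<omega>. \<lambda>g\<in>carrier G. \<omega> (g \<otimes>\<^bsub>G\<^esub> h)) \<in> measurable P P"
        using coord h unfolding P_def by (intro measurable_restrict) auto
      then show ?thesis by (subst measurable_cong[where g = "\<lambda>\<omega>. \<lambda>g\<in>carrier G. \<omega> (g \<otimes>\<^bsub>G\<^esub> h)"])
          (auto simp: \<psi>_def)
    qed
    have \<pi>_space: "\<pi> x \<in> space P" for x by (simp add: \<pi>_def space_P)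
    have equivariant: "\<psi> h (\<pi> x) = \<pi> (\<phi> h x)" if "h \<in> carrier G" "x \<in> space M" for h x
      using that \<pi>_space[of x] comp by (auto simp: \<psi>_def \<pi>_def intro!: restrict_ext)
    have act': "measure_preserving_action G M' \<psi>"
      unfolding measure_preserving_action_def
    proof (intro conjI ballI)
      show "group_action G (space M') \<psi>"
      proof (rule group_actionI[OF \<open>group G\<close>])
        show "\<psi> h \<in> extensional (space M')" if "h \<in> carrier G" for h by (simp add: \<psi>_def)
        show "\<psi> h \<omega> \<in> space M'" if "h \<in> carrier G" "\<omega> \<in> space M'" for h \<omega>
          using that by (simp add: \<psi>_def space_P)
        show "\<psi> \<one>\<^bsub>G\<^esub> \<omega> = \<omega>" if "\<omega> \<in> space M'" for \<omega>
          using that by (auto simp: \<psi>_def space_P PiE_def extensional_def fun_eq_iff)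
        show "\<psi> (g \<otimes>\<^bsub>G\<^esub> h) \<omega> = \<psi> g (\<psi> h \<omega>)" if "g \<in> carrier G" "h \<in> carrier G" "\<omega> \<in> space M'" for g h \<omega>
          using that by (auto simp: \<psi>_def space_P m_assoc intro!: restrict_ext)
      qed
      fix h assume h: "h \<in> carrier G"
      show "\<psi> h \<in> measurable M' M'" using \<psi>_meas[OF h] by (simp cong: measurable_cong_sets)
      have "distr M' M' (\<psi> h) = distr (distr M P \<pi>) P (\<psi> h)"
        by (rule distr_cong) (auto simp: M'_def)
      also have "\<dots> = distr M P (\<psi> h \<circ> \<pi>)" by (rule distr_distr[OF \<psi>_meas[OF h] \<pi>_meas])
      also have "\<dots> = distr M P (\<pi> \<circ> \<phi> h)"
        using equivariant[OF h] by (intro distr_cong) auto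
      also have "\<dots> = distr (distr M M (\<phi> h)) P \<pi>"
        by (rule distr_distr[OF \<pi>_meas \<phi>_meas[OF h], symmetric])
      also have "\<dots> = M'" using \<phi>_pres[OF h] by (simp add: M'_def)
      finally show "distr M' M' (\<psi> h) = M'" .
    qed
    have f'_meas: "f' \<in> borel_measurable P"
      unfolding f'_def using coord[OF one_closed] by (intro borel_measurable_max) auto
    define a' where "a' \<omega> k = avg (word_ball G S (real k)) (\<lambda>g. f' (\<psi> g \<omega>))" for \<omega> and k :: nat
    have a'_meas: "(\<lambda>\<omega>. a' \<omega> k) \<in> borel_measurable P" for k
    proof -
      have "(\<lambda>\<omega>. f' (\<psi> g \<omega>)) \<in> borel_measurable P" if "g \<in> word_ball G S (real k)" for g
        using that measurable_compose[OF \<psi>_meas f'_meas] by (auto simp: word_ball_def)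
      then show ?thesis unfolding a'_def avg_def by (intro borel_measurable_divide borel_measurable_sum) auto
    qed
    have a'_\<pi>: "a' (\<pi> x) = (\<lambda>k. avg (word_ball G S (real k)) (\<lambda>g. f (\<phi> g x)))" if x: "x \<in> space M" for x
    proof
      fix k
      have "f' (\<psi> g (\<pi> x)) = f (\<phi> g x)" if g: "g \<in> word_ball G S (real k)" for g
      proof -
        have gG: "g \<in> carrier G" using g by (simp add: word_ball_def)
        have "\<phi> \<one>\<^bsub>G\<^esub> (\<phi> g x) = \<phi> g x" using comp[OF x one_closed gG] gG by simp
        then have "\<pi> (\<phi> g x) \<one>\<^bsub>G\<^esub> = f (\<phi> g x)" by (simp add: \<pi>_def)
        moreover have "0 \<le> f (\<phi> g x)" using f0 \<phi>_space[OF x gG] by blast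
        ultimately show ?thesis unfolding equivariant[OF gG x] f'_def by simp
      qed
      then show "a' (\<pi> x) k = avg (word_ball G S (real k)) (\<lambda>g. f (\<phi> g x))"
        by (simp add: a'_def avg_def)
    qed
    let ?Z = "{\<omega> \<in> space P. a' \<omega> \<in> fluctuating \<alpha> \<beta> N}"
    have Z: "?Z \<in> sets P" by (rule fluctuating_measurable[OF a'_meas])
    have "measure M' ?Z = measure M (\<pi> -` ?Z \<inter> space M)"
      unfolding M'_def by (rule measure_distr[OF \<pi>_meas Z])
    also have "\<pi> -` ?Z \<inter> space M =
        {x \<in> space M. (\<lambda>k. avg (word_ball G S (real k)) (\<lambda>g. f (\<phi> g x))) \<in> fluctuating \<alpha> \<beta> N}"
      using a'_\<pi> \<pi>_space by auto
    finally have eq: "measure M {x \<in> space M. (\<lambda>k. avg (word_ball G S (real k)) (\<lambda>g. f (\<phi> g x)))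
        \<in> fluctuating \<alpha> \<beta> N} = measure M' ?Z" by simp
    have "prob_space M'" unfolding M'_def by (rule prob_space.prob_space_distr[OF prob \<pi>_meas])
    moreover have "f' \<in> borel_measurable M'" using f'_meas by (simp cong: measurable_cong_sets)
    moreover have "\<forall>\<omega>\<in>space M'. 0 \<le> f' \<omega>" by (simp add: f'_def)
    ultimately have "measure M' {\<omega> \<in> space M'. (\<lambda>k. avg (word_ball G S (real k)) (\<lambda>g. f' (\<psi> g \<omega>)))
        \<in> fluctuating \<alpha> \<beta> N} < c1 * c2 ^ N"
      using adm act' N unfolding admissible_constants_def by blast
    then show ?thesis unfolding eq by (simp add: a'_def[abs_def])
  qed
  then show ?thesis using adm by (auto simp: admissible_constants_def)
qed

theorem theorem3p1:
  fixes G :: "('g, 'b) monoid_scheme" and S :: "'g set" and d :: nat and \<alpha> \<beta> :: real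
  assumes "group G"
    and "generating_set G S"
    and "polynomial_growth G S"
    and "growth_degree G S d"
    and "{\<alpha><..<\<beta>} \<noteq> {}"
    and "{\<alpha><..<\<beta>} \<subseteq> {0<..}"
  shows "\<exists>c1 c2. (c1, c2) = uniform_constants G S \<alpha> \<beta> \<and> 0 < c1 \<and> 0 < c2 \<and> c2 < 1 \<and>
    (\<forall>(M :: 'x measure) \<phi> f.
       prob_space M \<longrightarrow> measure_preserving_action G M \<phi> \<longrightarrow>
       f \<in> borel_measurable M \<longrightarrow> (\<forall>x\<in>space M. 0 \<le> f x) \<longrightarrow>
       (\<forall>N\<ge>1. measure M {x \<in> space M.
            (\<lambda>k. avg (word_ball G S (real k)) (\<lambda>g. f (\<phi> g x))) \<in> fluctuating \<alpha> \<beta> N}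
          < c1 * c2 ^ N))"
proof -
  have lt: "\<alpha> < \<beta>" using assms(5) by auto
  have "0 \<le> \<alpha>"
  proof (rule ccontr)
    assume "\<not> 0 \<le> \<alpha>"
    then have "\<alpha> < min \<beta> 0" using lt by simp
    then obtain t where t: "\<alpha> < t" "t < min \<beta> 0" using dense by blast
    then have "t \<in> {0<..}" using assms(6) by auto
    then show False using t by simp
  qed
  have "\<exists>c. case c of (c1, c2) \<Rightarrow> admissible_constants TYPE('g \<Rightarrow> real) G S \<alpha> \<beta> c1 c2"
    using admissible_constants_exist[OF assms(1,2,4) \<open>0 \<le> \<alpha>\<close> lt] by auto
  then have "case uniform_constants G S \<alpha> \<beta> of
      (c1, c2) \<Rightarrow> admissible_constants TYPE('g \<Rightarrow> real) G S \<alpha> \<beta> c1 c2"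
    unfolding uniform_constants_def by (rule someI_ex)
  then obtain c1 c2 where c: "(c1, c2) = uniform_constants G S \<alpha> \<beta>"
    and "admissible_constants TYPE('g \<Rightarrow> real) G S \<alpha> \<beta> c1 c2"
    by (cases "uniform_constants G S \<alpha> \<beta>") auto
  then have "admissible_constants TYPE('x) G S \<alpha> \<beta> c1 c2"
    using admissible_constants_transfer[OF assms(1)] by blast
  then show ?thesis using c by (intro exI[of _ c1] exI[of _ c2]) (auto simp: admissible_constants_def)
qed

end
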